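(* Let $0<q<1$, $l>0$, $c>0$, $\lambda_k=\frac{cq^k}{2(1-q)}$ for $k\in\mathbb Z$, and let $\mathsf H_c$ be the Hilbert space defined as the closed subspace of $\mathfrak l^2_c$ spanned by the sequences $\{P_n(\lambda_k)\mid k\in\mathbb Z\}$, $n=0,1,2,\dots$, where $P_n(\lambda)=q^{n/2}\frac{(q;q)_n^{1/2}}{(q^{2l};q)_n^{1/2}}L_n^{(2l-1)}(2(1-q)\lambda;q)$. Then the discrete series representation $T^+_l$ of $U_q(\mathrm{su}_{1,1})$ is defined on $\mathsf H_c$. In particular, the operators $q^{J_0}$ and $J_\pm$ act on the basis $\{P_n(\lambda_k)\mid k\in\mathbb Z\}$, $n=0,1,2,\dots$, of this space as $$q^{J_0}\{P_n(\lambda_k)\mid k\in\mathbb Z\}=q^{l+n}\{P_n(\lambda_k)\mid k\in\mathbb Z\},$$ $$J_+\{P_n(\lambda_k)\mid k\in\mathbb Z\}=\sqrt{[2l+n]_q[n+1]_q}\,\{P_{n+1}(\lambda_k)\mid k\in\mathbb Z\},$$ $$J_-\{P_n(\lambda_k)\mid k\in\mathbb Z\}=\sqrt{[2l+n-1]_q[n]_q}\,\{P_{n-1}(\lambda_k)\mid k\in\mathbb Z\}.$$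
   Context: Notation: $(a;q)_n=\prod_{r=0}^{n-1}(1-aq^r)$, $(a;q)_\infty=\prod_{r\ge0}(1-aq^r)$, and for a real index $s$, $(a;q)_s=(a;q)_\infty/(aq^s;q)_\infty$; $[a]_q=\frac{q^{a/2}-q^{-a/2}}{q^{1/2}-q^{-1/2}}$. The algebra $U_q(\mathrm{su}_{1,1})$ is generated by $J_0,J_\pm$ with $[J_0,J_\pm]=\pm J_\pm$, $[J_-,J_+]=[2J_0]_q$, and $J_0^*=J_0$, $J_+^*=J_-$. The representation $T^+_l$ ($l>0$) acts on a Hilbert space with orthonormal basis $f^l_n$, $n\ge0$, by $J_0f^l_n=(l+n)f^l_n$, $J_+f^l_n=\sqrt{[2l+n]_q[n+1]_q}\,f^l_{n+1}$, $J_-f^l_n=\sqrt{[2l+n-1]_q[n]_q}\,f^l_{n-1}$. $q$-Laguerre polynomials: $L_n^{(\alpha)}(y;q)=\frac{(q^{\alpha+1};q)_n}{(q;q)_n}\sum_{k=0}^n\frac{(q^{-n};q)_k\,y^k}{(q^{\alpha+1};q)_k(q;q)_k}\,q^{k[n+\alpha+(k+1)/2]}$. $\mathfrak l^2_c$ is the Hilbert space of sequences $\mathbf a=\{a_k\mid k\in\mathbb Z\}$ with $\sum_{k\in\mathbb Z}q^{2lk}|a_k|^2/(-cq^k;q)_\infty<\infty$ and scalar product $\langle\mathbf a,\mathbf a'\rangle_c=b_c\sum_{k\in\mathbb Z}\frac{q^{2lk}}{(-cq^k;q)_\infty}a_k\overline{a'_k}$, where $b_c=c^{2l}q^{l(2l-1)}(q;q)_{2l-1}$.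 *)

theory Defs
  imports "HOL-Analysis.Analysis" "HOL-Library.Function_Algebras"
begin

section \<open>\<open>q\<close>-notation\<close>

definition qpoch :: "real \<Rightarrow> real \<Rightarrow> nat \<Rightarrow> real" where
  "qpoch a q n = (\<Prod>r<n. 1 - a * q ^ r)"

definition qpoch_inf :: "real \<Rightarrow> real \<Rightarrow> real" where
  "qpoch_inf a q = prodinf (\<lambda>r. 1 - a * q ^ r)"

definition qpoch_real :: "real \<Rightarrow> real \<Rightarrow> real \<Rightarrow> real" where
  "qpoch_real a q s = qpoch_inf a q / qpoch_inf (a * q powr s) q"

definition qnum :: "real \<Rightarrow> real \<Rightarrow> real" where
  "qnum q a = (q powr (a / 2) - q powr (- a / 2)) / (q powr (1 / 2) - q powr (- 1 / 2))"

definition qLaguerre :: "nat \<Rightarrow> real \<Rightarrow> real \<Rightarrow> real \<Rightarrow> real" where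
  "qLaguerre n \<alpha> y q =
     qpoch (q powr (\<alpha> + 1)) q n / qpoch q q n *
     (\<Sum>k=0..n. qpoch (q powr (- real n)) q k * y ^ k /
        (qpoch (q powr (\<alpha> + 1)) q k * qpoch q q k) *
        q powr (real k * (real n + \<alpha> + (real k + 1) / 2)))"

section \<open>Complex sequences indexed by the integers\<close>

text \<open>Addition and zero are the pointwise operations of \<^theory>\<open>HOL-Library.Function_Algebras\<close>.\<close>

type_synonym cseq = "int \<Rightarrow> complex"

definition cscale :: "complex \<Rightarrow> cseq \<Rightarrow> cseq" (infixr "*\<^sub>c" 75) where
  "z *\<^sub>c a = (\<lambda>k. z * a k)"

interpretation cseq: vector_space cscale
  by unfold_locales (auto simp: cscale_def algebra_simps fun_eq_iff)

text \<open>The notions below refer to a form \<open>ip\<close>, linear in its first and conjugate-linear in its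
  second argument, of which only the values on a given space of sequences matter.\<close>

type_synonym form = "cseq \<Rightarrow> cseq \<Rightarrow> complex"

definition ip_norm :: "form \<Rightarrow> cseq \<Rightarrow> real" where
  "ip_norm ip a = sqrt (Re (ip a a))"

definition inner_product_on :: "form \<Rightarrow> cseq set \<Rightarrow> bool" where
  "inner_product_on ip H \<longleftrightarrow>
     cseq.subspace H \<and>
     (\<forall>x\<in>H. \<forall>y\<in>H. \<forall>z\<in>H. ip (x + y) z = ip x z + ip y z) \<and>
     (\<forall>x\<in>H. \<forall>y\<in>H. \<forall>w. ip (w *\<^sub>c x) y = w * ip x y) \<and>
     (\<forall>x\<in>H. \<forall>y\<in>H. ip y x = cnj (ip x y)) \<and>
     (\<forall>x\<in>H. x \<noteq> 0 \<longrightarrow> Re (ip x x) > 0)"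

definition hilbert_space_on :: "form \<Rightarrow> cseq set \<Rightarrow> bool" where
  "hilbert_space_on ip H \<longleftrightarrow>
     inner_product_on ip H \<and>
     (\<forall>X :: nat \<Rightarrow> cseq.
        (\<forall>n. X n \<in> H) \<and> (\<forall>e>0. \<exists>N. \<forall>m\<ge>N. \<forall>n\<ge>N. ip_norm ip (X m - X n) < e) \<longrightarrow>
        (\<exists>x\<in>H. (\<lambda>n. ip_norm ip (X n - x)) \<longlonglongrightarrow> 0))"

definition closure_in :: "form \<Rightarrow> cseq set \<Rightarrow> cseq set \<Rightarrow> cseq set" where
  "closure_in ip L S = {a \<in> L. \<forall>e>0. \<exists>s\<in>S. ip_norm ip (a - s) < e}"

definition orthogonal_basis :: "form \<Rightarrow> cseq set \<Rightarrow> (nat \<Rightarrow> cseq) \<Rightarrow> bool" where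
  "orthogonal_basis ip H f \<longleftrightarrow>
     (\<forall>n. f n \<in> H \<and> f n \<noteq> 0) \<and>
     (\<forall>m n. m \<noteq> n \<longrightarrow> ip (f m) (f n) = 0) \<and>
     closure_in ip H (cseq.span (range f)) = H"

definition orthonormal_basis :: "form \<Rightarrow> cseq set \<Rightarrow> (nat \<Rightarrow> cseq) \<Rightarrow> bool" where
  "orthonormal_basis ip H f \<longleftrightarrow> orthogonal_basis ip H f \<and> (\<forall>n. ip (f n) (f n) = 1)"

section \<open>Operators on a domain and representations of \<open>U\<^sub>q(su\<^sub>1\<^sub>,\<^sub>1)\<close>\<close>

definition linear_operator_on :: "cseq set \<Rightarrow> (cseq \<Rightarrow> cseq) \<Rightarrow> bool" where
  "linear_operator_on D A \<longleftrightarrow>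
     (\<forall>x\<in>D. A x \<in> D) \<and>
     (\<forall>x\<in>D. \<forall>y\<in>D. A (x + y) = A x + A y) \<and>
     (\<forall>x\<in>D. \<forall>w. A (w *\<^sub>c x) = w *\<^sub>c A x)"

text \<open>\<open>B = \<phi>(A)\<close> on \<open>D\<close>, for an operator \<open>A\<close> that is diagonalizable on \<open>D\<close> with real
  eigenvalues: \<open>B\<close> multiplies each eigenvector of \<open>A\<close> with eigenvalue \<open>\<mu>\<close> by \<open>\<phi> \<mu>\<close>.
  This determines \<open>B\<close> on \<open>D\<close>.\<close>

definition operator_function ::
    "cseq set \<Rightarrow> (cseq \<Rightarrow> cseq) \<Rightarrow> (real \<Rightarrow> real) \<Rightarrow> (cseq \<Rightarrow> cseq) \<Rightarrow> bool" where
  "operator_function D A \<phi> B \<longleftrightarrow>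
     linear_operator_on D B \<and>
     D = cseq.span {v \<in> D. \<exists>\<mu>::real. A v = complex_of_real \<mu> *\<^sub>c v} \<and>
     (\<forall>v\<in>D. \<forall>\<mu>::real. A v = complex_of_real \<mu> *\<^sub>c v \<longrightarrow> B v = complex_of_real (\<phi> \<mu>) *\<^sub>c v)"

text \<open>A \<open>*\<close>-representation by (in general unbounded) operators with common dense invariant
  domain \<open>D\<close> in \<open>H\<close>; the involution is understood on \<open>D\<close>.\<close>

definition Uq_su11_star_rep ::
    "real \<Rightarrow> form \<Rightarrow> cseq set \<Rightarrow> cseq set \<Rightarrow>
     (cseq \<Rightarrow> cseq) \<Rightarrow> (cseq \<Rightarrow> cseq) \<Rightarrow> (cseq \<Rightarrow> cseq) \<Rightarrow> bool" where
  "Uq_su11_star_rep q ip H D J0 Jp Jm \<longleftrightarrow>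
     cseq.subspace D \<and> D \<subseteq> H \<and> closure_in ip H D = H \<and>
     linear_operator_on D J0 \<and> linear_operator_on D Jp \<and> linear_operator_on D Jm \<and>
     (\<forall>x\<in>D. J0 (Jp x) - Jp (J0 x) = Jp x) \<and>
     (\<forall>x\<in>D. J0 (Jm x) - Jm (J0 x) = - Jm x) \<and>
     (\<exists>B. operator_function D J0 (\<lambda>\<mu>. qnum q (2 * \<mu>)) B \<and>
          (\<forall>x\<in>D. Jm (Jp x) - Jp (Jm x) = B x)) \<and>
     (\<forall>x\<in>D. \<forall>y\<in>D. ip (J0 x) y = ip x (J0 y)) \<and>
     (\<forall>x\<in>D. \<forall>y\<in>D. ip (Jp x) y = ip x (Jm y))"

text \<open>In the last two clauses \<open>f (n - 1)\<close> at \<open>n = 0\<close> is harmless, its coefficient being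
  \<open>0\<close>.\<close>

definition ladder_action ::
    "real \<Rightarrow> real \<Rightarrow> (nat \<Rightarrow> cseq) \<Rightarrow> (cseq \<Rightarrow> cseq) \<Rightarrow> (cseq \<Rightarrow> cseq) \<Rightarrow> bool" where
  "ladder_action q l f Jp Jm \<longleftrightarrow>
     (\<forall>n. Jp (f n) =
        complex_of_real (sqrt (qnum q (2 * l + real n) * qnum q (real n + 1))) *\<^sub>c f (n + 1)) \<and>
     (\<forall>n. Jm (f n) =
        complex_of_real (sqrt (qnum q (2 * l + real n - 1) * qnum q (real n))) *\<^sub>c f (n - 1))"

text \<open>The representation \<open>T\<^sup>+\<^sub>l\<close> on the Hilbert space \<open>H\<close>, with orthonormal basis \<open>f\<close>; the
  domain of the operators is the linear span of \<open>f\<close>.\<close>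

definition discrete_series_rep ::
    "real \<Rightarrow> real \<Rightarrow> form \<Rightarrow> cseq set \<Rightarrow> (nat \<Rightarrow> cseq) \<Rightarrow>
     (cseq \<Rightarrow> cseq) \<Rightarrow> (cseq \<Rightarrow> cseq) \<Rightarrow> (cseq \<Rightarrow> cseq) \<Rightarrow> bool" where
  "discrete_series_rep q l ip H f J0 Jp Jm \<longleftrightarrow>
     hilbert_space_on ip H \<and>
     orthonormal_basis ip H f \<and>
     Uq_su11_star_rep q ip H (cseq.span (range f)) J0 Jp Jm \<and>
     (\<forall>n. J0 (f n) = complex_of_real (l + real n) *\<^sub>c f n) \<and>
     ladder_action q l f Jp Jm"

section \<open>The spaces \<open>\<ll>\<^sup>2\<^sub>c\<close> and \<open>H\<^sub>c\<close>\<close>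

definition weight :: "real \<Rightarrow> real \<Rightarrow> real \<Rightarrow> int \<Rightarrow> real" where
  "weight q l c k = q powr (2 * l * of_int k) / qpoch_inf (- (c * q powi k)) q"

definition l2c :: "real \<Rightarrow> real \<Rightarrow> real \<Rightarrow> cseq set" where
  "l2c q l c = {a. (\<lambda>k. weight q l c k * (cmod (a k))\<^sup>2) summable_on UNIV}"

definition b_const :: "real \<Rightarrow> real \<Rightarrow> real \<Rightarrow> real" where
  "b_const q l c = c powr (2 * l) * q powr (l * (2 * l - 1)) * qpoch_real q q (2 * l - 1)"

definition ip_c :: "real \<Rightarrow> real \<Rightarrow> real \<Rightarrow> form" where
  "ip_c q l c a a' = complex_of_real (b_const q l c) *
     (\<Sum>\<^sub>\<infinity>k. complex_of_real (weight q l c k) * a k * cnj (a' k))"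

definition lam :: "real \<Rightarrow> real \<Rightarrow> int \<Rightarrow> real" where
  "lam q c k = c * q powi k / (2 * (1 - q))"

definition P :: "real \<Rightarrow> real \<Rightarrow> nat \<Rightarrow> real \<Rightarrow> real" where
  "P q l n x = q powr (real n / 2) * (sqrt (qpoch q q n) / sqrt (qpoch (q powr (2 * l)) q n)) *
     qLaguerre n (2 * l - 1) (2 * (1 - q) * x) q"

definition Pseq :: "real \<Rightarrow> real \<Rightarrow> real \<Rightarrow> nat \<Rightarrow> cseq" where
  "Pseq q l c n = (\<lambda>k. complex_of_real (P q l n (lam q c k)))"

definition H_c :: "real \<Rightarrow> real \<Rightarrow> real \<Rightarrow> cseq set" where
  "H_c q l c = closure_in (ip_c q l c) (l2c q l c) (cseq.span (range (Pseq q l c)))"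

end

theory Submission
  imports Defs
begin

text \<open>
  On the grid \<open>y = c q\<^sup>k\<close> the weight satisfies \<open>w (k + 1) = q\<^sup>2\<^sup>l (1 + c q\<^sup>k) w k\<close>.  Shifting the
  summation index therefore yields a two-term recurrence for the moments, which gives
  \<open>\<mu>\<^sub>j = \<mu>\<^sub>0 (q\<^sup>2\<^sup>l; q)\<^sub>j q\<^bsup>-2lj - j(j-1)/2\<^esup>\<close>.  With these moments the sums
  \<open>\<langle>L\<^sub>n, y\<^sup>m\<rangle>\<close>, \<open>m \<le> n\<close>, are evaluated by the terminating \<open>q\<close>-binomial theorem: they vanish for
  \<open>m < n\<close>, and the value for \<open>m = n\<close> shows that all \<open>P\<^sub>n\<close> have the same norm.  So a common
  multiple of the \<open>P\<^sub>n\<close> is an orthonormal basis of \<open>H\<^sub>c\<close>, and the operators of the discrete series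
  may be defined on it by linear extension; the one identity needed is
  \<open>[x] [y + 1] - [x - 1] [y] = [x + y]\<close> for \<open>q\<close>-numbers.
\<close>

section \<open>Terminating \<open>q\<close>-binomial sums\<close>

lemma qpoch_0 [simp]: "qpoch a q 0 = 1"
  by (simp add: qpoch_def)

lemma qpoch_Suc: "qpoch a q (Suc n) = qpoch a q n * (1 - a * q ^ n)"
  by (simp add: qpoch_def)

lemma qpoch_Suc_shift: "qpoch a q (Suc n) = (1 - a) * qpoch (a * q) q n"
  unfolding qpoch_def prod.lessThan_Suc_shift by (simp add: mult.assoc)

lemma qpoch_add: "qpoch a q (m + n) = qpoch a q m * qpoch (a * q ^ m) q n"
  by (induction n) (simp_all add: qpoch_Suc power_add mult.assoc)

lemma qpoch_factor_pos:
  fixes a q :: real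
  assumes "0 < q" "q < 1" "a < 1"
  shows "0 < 1 - a * q ^ r"
proof (cases "0 \<le> a")
  case True
  then have "a * q ^ r \<le> a"
    using assms by (intro mult_left_le) (auto intro: power_le_one)
  then show ?thesis using assms by linarith
next
  case False
  then have "a * q ^ r < 0" using assms by (simp add: mult_neg_pos)
  then show ?thesis by simp
qed

lemma qpoch_pos:
  assumes "0 < q" "q < 1" "a < 1"
  shows "0 < qpoch a q n"
  unfolding qpoch_def using qpoch_factor_pos[OF assms] by (intro prod_pos) auto

text \<open>For \<open>0 < j\<close> and \<open>j \<le> n\<close> the index \<open>n - j\<close> is
  in range, and its factor is \<open>1 - q ^ 0\<close>.\<close>

lemma qpoch_neg_power_eq_0:
  assumes "q \<noteq> 0" "0 < j" "j \<le> n"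
  shows "qpoch (q ^ j / q ^ n) q n = 0"
  unfolding qpoch_def
proof (rule prod_zero)
  show "\<exists>r\<in>{..<n}. 1 - q ^ j / q ^ n * q ^ r = 0"
    using assms by (intro bexI[of _ "n - j"]) (auto simp flip: power_add)
qed auto

text \<open>Reversing the product gives (q^-n; q)_n = (-1)^n (q; q)_n q^(-n(n+1)/2); the powers
  stand on the left so that exponents stay natural. The induction peels off the first factor, which
  leaves the product for \<open>n\<close>.\<close>

lemma qpoch_neg_power:
  assumes "q \<noteq> 0"
  shows "qpoch (1 / q ^ n) q n * q ^ (n choose 2) * q ^ n = (- 1) ^ n * qpoch q q n"
proof (induction n)
  case (Suc n)
  have *: "1 / q ^ Suc n * q = 1 / q ^ n"
    using assms by simp
  have "qpoch (1 / q ^ Suc n) q (Suc n) = (1 - 1 / q ^ Suc n) * qpoch (1 / q ^ n) q n"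
    unfolding qpoch_Suc_shift[of "1 / q ^ Suc n"] * ..
  moreover have "Suc n choose 2 = n + (n choose 2)"
    by (simp add: numeral_2_eq_2)
  ultimately have "qpoch (1 / q ^ Suc n) q (Suc n) * q ^ (Suc n choose 2) * q ^ Suc n
      = ((1 - 1 / q ^ Suc n) * q ^ Suc n) * (qpoch (1 / q ^ n) q n * q ^ (n choose 2) * q ^ n)"
    by (simp only: power_add mult_ac)
  also have "(1 - 1 / q ^ Suc n) * q ^ Suc n = - (1 - q * q ^ n)"
    using assms by (simp add: field_simps)
  finally show ?case
    by (simp only: Suc qpoch_Suc) (simp add: algebra_simps)
qed (simp add: numeral_2_eq_2)

text \<open>Up to sign and a power of \<open>q\<close> this is the Gaussian binomial coefficient.\<close>

definition qbin_coeff :: "real \<Rightarrow> nat \<Rightarrow> nat \<Rightarrow> real" where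
  "qbin_coeff q n k = qpoch (1 / q ^ n) q k / qpoch q q k"

lemma qbin_coeff_0 [simp]: "qbin_coeff q n 0 = 1"
  by (simp add: qbin_coeff_def)

lemma qbin_coeff_eq_0:
  assumes "q \<noteq> 0" "n < k"
  shows "qbin_coeff q n k = 0"
proof -
  have "qpoch (1 / q ^ n) q k = 0"
    unfolding qpoch_def using assms by (intro prod_zero bexI[of _ n]) auto
  then show ?thesis by (simp add: qbin_coeff_def)
qed

text \<open>A q-Pascal rule: over the denominator \<open>qpoch q q (Suc k)\<close> all three terms
  share the factor \<open>X\<close>, and an identity between powers of \<open>q\<close>
  remains.\<close>

lemma qbin_coeff_Suc_Suc:
  assumes "0 < q" "q < 1"
  shows "qbin_coeff q (Suc n) (Suc k) = qbin_coeff q n (Suc k) - qbin_coeff q n k / q ^ Suc n"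
proof -
  define X where "X = qpoch (1 / q ^ n) q k"
  have nz: "qpoch q q k \<noteq> 0" "qpoch q q (Suc k) \<noteq> 0"
    using qpoch_pos[OF assms, of q] assms by (metis less_irrefl)+
  then have nz': "1 - q * q ^ k \<noteq> 0" by (simp add: qpoch_Suc)
  have *: "1 / q ^ Suc n * q = 1 / q ^ n"
    using assms by simp
  have "qbin_coeff q (Suc n) (Suc k) = (1 - 1 / q ^ Suc n) * X / qpoch q q (Suc k)"
    unfolding qbin_coeff_def qpoch_Suc_shift[of "1 / q ^ Suc n"] * X_def ..
  moreover have "qbin_coeff q n (Suc k) = X * (1 - q ^ k / q ^ n) / qpoch q q (Suc k)"
    by (simp add: qbin_coeff_def qpoch_Suc[of "1 / q ^ n"] X_def)
  moreover have "qbin_coeff q n k / q ^ Suc n = X * (1 - q * q ^ k) / q ^ Suc n / qpoch q q (Suc k)"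
    using nz nz' by (simp add: qbin_coeff_def X_def qpoch_Suc[of q])
  moreover have "(1 - 1 / q ^ Suc n) * X = X * (1 - q ^ k / q ^ n) - X * (1 - q * q ^ k) / q ^ Suc n"
    using assms by (simp add: field_simps)
  ultimately show ?thesis by (simp add: diff_divide_distrib)
qed

text \<open>The Pascal rule makes the sum for \<open>Suc n\<close> equal to
  \<open>1 - z / q ^ Suc n\<close> times the sum for \<open>n\<close>, and this is the new head
  factor of the product.\<close>

lemma q_binomial:
  assumes "0 < q" "q < 1"
  shows "(\<Sum>k\<le>n. qbin_coeff q n k * z ^ k) = qpoch (z / q ^ n) q n"
proof (induction n)
  case (Suc n)
  have "(\<Sum>k\<le>Suc n. qbin_coeff q (Suc n) k * z ^ k)
      = 1 + (\<Sum>k\<le>n. qbin_coeff q (Suc n) (Suc k) * z ^ Suc k)"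
    by (subst sum.atMost_Suc_shift) simp
  also have "\<dots> = 1 + (\<Sum>k\<le>n. qbin_coeff q n (Suc k) * z ^ Suc k)
      - (\<Sum>k\<le>n. qbin_coeff q n k * z ^ k) * (z / q ^ Suc n)"
    by (simp only: qbin_coeff_Suc_Suc[OF assms] left_diff_distrib sum_subtractf sum_distrib_right)
       (simp add: field_simps)
  also have "1 + (\<Sum>k\<le>n. qbin_coeff q n (Suc k) * z ^ Suc k) = (\<Sum>k\<le>Suc n. qbin_coeff q n k * z ^ k)"
    by (simp add: sum.atMost_Suc_shift[of "\<lambda>k. qbin_coeff q n k * z ^ k"] del: sum.atMost_Suc)
  \<comment> \<open>The term \<open>k = Suc n\<close> vanishes by
    \<open>qbin_coeff_eq_0\<close>.\<close>
  also have "\<dots> = (\<Sum>k\<le>n. qbin_coeff q n k * z ^ k)"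
    using assms by (simp add: qbin_coeff_eq_0)
  also have "\<dots> - \<dots> * (z / q ^ Suc n) = (1 - z / q ^ Suc n) * qpoch (z / q ^ n) q n"
    by (simp only: Suc) (simp add: algebra_simps)
  also have "\<dots> = qpoch (z / q ^ Suc n) q (Suc n)"
    using assms by (simp add: qpoch_Suc_shift)
  finally show ?case .
qed simp

text \<open>The last factor \<open>1 - a * q ^ m * q ^ k\<close> splits the sum into one with
  exponent \<open>j\<close> and one with \<open>Suc j\<close>, both within the bound
  \<open>n\<close>. At \<open>m = 0\<close> the q-binomial theorem with \<open>z = q ^ j\<close>
  gives zero unless \<open>j = 0\<close>, so only the constant term in \<open>q ^ k\<close>
  survives.\<close>

lemma sum_qbin_coeff_qpoch:
  assumes "0 < q" "q < 1" "m + j \<le> n"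
  shows "(\<Sum>k\<le>n. qbin_coeff q n k * (q ^ k) ^ j * qpoch (a * q ^ k) q m)
    = (if j = 0 then qpoch (1 / q ^ n) q n else 0)"
  using assms(3)
proof (induction m arbitrary: j)
  case 0
  have "(\<Sum>k\<le>n. qbin_coeff q n k * (q ^ k) ^ j * qpoch (a * q ^ k) q 0)
      = (\<Sum>k\<le>n. qbin_coeff q n k * (q ^ j) ^ k)"
    by (simp flip: power_mult add: mult.commute)
  also have "\<dots> = qpoch (q ^ j / q ^ n) q n"
    by (rule q_binomial[OF assms(1,2)])
  finally show ?case
    using 0 assms qpoch_neg_power_eq_0[of q j n] by auto
next
  case (Suc m)
  have "(\<Sum>k\<le>n. qbin_coeff q n k * (q ^ k) ^ j * qpoch (a * q ^ k) q (Suc m))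
     = (\<Sum>k\<le>n. qbin_coeff q n k * (q ^ k) ^ j * qpoch (a * q ^ k) q m)
     - a * q ^ m * (\<Sum>k\<le>n. qbin_coeff q n k * (q ^ k) ^ Suc j * qpoch (a * q ^ k) q m)"
    unfolding sum_distrib_left by (simp flip: sum_subtractf add: qpoch_Suc algebra_simps)
  then show ?case
    using Suc.IH[of j] Suc.IH[of "Suc j"] Suc.prems by simp
qed

section \<open>The weight and its moments\<close>

lemma convergent_prod_qpoch:
  assumes "0 < q" "q < 1"
  shows "convergent_prod (\<lambda>r. 1 - a * q ^ r :: real)"
proof (rule abs_convergent_prod_imp_convergent_prod, rule summable_imp_abs_convergent_prod)
  show "summable (\<lambda>r. norm (1 - a * q ^ r - 1))"
    using assms by (simp add: abs_mult power_abs summable_mult summable_geometric)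
qed

lemma qpoch_inf_pos:
  assumes "0 < q" "q < 1" "a < 1"
  shows "0 < qpoch_inf a q"
  unfolding qpoch_inf_def
  by (rule less_0_prodinf[OF convergent_prod_qpoch[OF assms(1,2)] qpoch_factor_pos[OF assms]])

lemma qpoch_inf_shift:
  assumes "0 < q" "q < 1" "a < 1"
  shows "qpoch_inf a q = (1 - a) * qpoch_inf (a * q) q"
  unfolding qpoch_inf_def
  using prodinf_split_head[OF convergent_prod_qpoch[OF assms(1,2), of a]]
    qpoch_factor_pos[OF assms, THEN less_imp_neq, symmetric]
    assms
  by (simp add: mult_ac)

text \<open>The integers split into 0, 1, 2, ... and -1, -2, ...; the third series contains index 0
  once more, so only its tail is used.\<close>

lemma summable_on_int:
  fixes f :: "int \<Rightarrow> real"
  assumes "\<And>k. 0 \<le> f k" "summable (\<lambda>n. f (int n))" "summable (\<lambda>n. f (- int n))"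
  shows "f summable_on UNIV"
proof -
  have "f summable_on range int"
    using assms by (subst summable_on_reindex) (auto simp: summable_on_UNIV_nonneg_real_iff o_def)
  moreover have "f summable_on range (\<lambda>n. - int (Suc n))"
    using assms(1) summable_Suc_iff[THEN iffD2, OF assms(3)]
    by (subst summable_on_reindex) (auto simp: summable_on_UNIV_nonneg_real_iff o_def inj_def)
  moreover have "range int \<union> range (\<lambda>n. - int (Suc n)) = UNIV"
    using int_cases by (metis (no_types, lifting) UNIV_eq_I UnI1 UnI2 rangeI)
  moreover have "range int \<inter> range (\<lambda>n. - int (Suc n)) = {}"
    by auto
  ultimately show ?thesis
    using summable_on_Un_disjoint by metis
qed

locale q_Laguerre_weight =
  fixes q l c :: real
  assumes q: "0 < q" "q < 1" and l: "0 < l" and c: "0 < c"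
begin

text \<open>\<open>a\<close> is q^(\<alpha> + 1) for \<alpha> = 2l - 1, and \<open>y k\<close> is
  the Laguerre argument \<open>2 * (1 - q) * lam q c k\<close>.\<close>

abbreviation "a \<equiv> q powr (2 * l)"
abbreviation "w \<equiv> weight q l c"
abbreviation "y k \<equiv> c * q powi k"

lemma a_pos: "0 < a" and a_less_1: "a < 1"
  using q l powr_less_mono2[of "2 * l" q 1] by simp_all

lemma y_pos: "0 < y k"
  using q c by simp

lemma y_Suc: "y (k + 1) = q * y k"
  using q by (simp add: power_int_add)

lemma weight_pos: "0 < w k"
proof -
  have "0 < qpoch_inf (- y k) q"
    using y_pos[of k] by (intro qpoch_inf_pos q) linarith
  then show ?thesis using q by (simp add: weight_def)
qed

lemma weight_Suc: "w (k + 1) = a * (1 + y k) * w k"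
proof -
  have y1: "- y k < 1" using y_pos[of k] by linarith
  have "qpoch_inf (- y k) q = (1 + y k) * qpoch_inf (- y (k + 1)) q"
    using qpoch_inf_shift[OF q y1] unfolding y_Suc by (simp add: mult_ac)
  moreover have "0 < qpoch_inf (- y (k + 1)) q"
    using y_pos[of "k + 1"] by (intro qpoch_inf_pos q) linarith
  moreover have "1 + y k \<noteq> 0" using y_pos[of k] by linarith
  moreover have "q powr (2 * l * of_int (k + 1)) = a * q powr (2 * l * of_int k)"
    by (simp add: distrib_left add.commute flip: powr_add)
  moreover have "a * p / A = a * Y * (p / (Y * A))" if "Y \<noteq> 0" for p A Y :: real
    using that by simp
  ultimately show ?thesis
    unfolding weight_def by metis
qed

lemma weight_monomial_Suc:
  "w (k + 1) * y (k + 1) ^ j = a * q ^ j * (1 + y k) * (w k * y k ^ j)"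
  unfolding weight_Suc y_Suc by (simp add: power_mult_distrib)

text \<open>Ratio test at both ends. Towards +infinity the ratio tends to \<open>a * q ^ j\<close>,
  which is at most \<open>a < 1\<close>; towards -infinity \<open>y k\<close> is unbounded, so each
  step eventually at least halves the term.\<close>

lemma summable_on_weight_monomial: "(\<lambda>k. w k * y k ^ j) summable_on UNIV"
proof (rule summable_on_int)
  define u where "u k = w k * y k ^ j" for k
  have pos: "0 < u k" for k using weight_pos y_pos by (simp add: u_def)
  have rec: "u (k + 1) = a * q ^ j * (1 + y k) * u k" for k
    unfolding u_def by (rule weight_monomial_Suc)
  show "0 \<le> w k * y k ^ j" for k
    using pos[of k] by (simp add: u_def)
  have lim: "(\<lambda>n. q ^ n) \<longlonglongrightarrow> 0"
    using q by (intro LIMSEQ_power_zero) simp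
  have "(\<lambda>n. a * q ^ j * (1 + c * q ^ n)) \<longlonglongrightarrow> a * q ^ j * (1 + c * 0)"
    by (intro tendsto_intros lim)
  \<comment> \<open>\<open>(1 + a) / 2\<close> lies strictly between \<open>a\<close>, a bound for
    the limit, and 1.\<close>
  moreover have "a * q ^ j * (1 + c * 0) < (1 + a) / 2"
  proof -
    have "a * q ^ j \<le> a"
      using q by (intro mult_left_le) (auto intro: power_le_one)
    then show ?thesis using a_less_1 by simp
  qed
  ultimately have "\<forall>\<^sub>F n in sequentially. a * q ^ j * (1 + c * q ^ n) < (1 + a) / 2"
    by (rule order_tendstoD)
  then obtain N where N: "\<And>n. n \<ge> N \<Longrightarrow> a * q ^ j * (1 + c * q ^ n) < (1 + a) / 2"
    by (auto simp: eventually_sequentially)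
  show "summable (\<lambda>n. w (int n) * y (int n) ^ j)"
    unfolding u_def[symmetric]
  proof (rule summable_ratio_test)
    show "(1 + a) / 2 < 1" using a_less_1 by simp
    fix n assume "N \<le> n"
    then have "a * q ^ j * (1 + c * q ^ n) * u (int n) \<le> (1 + a) / 2 * u (int n)"
      using N pos by (intro mult_right_mono less_imp_le) auto
    then show "norm (u (int (Suc n))) \<le> (1 + a) / 2 * norm (u (int n))"
      using rec[of "int n"] pos[of "int n"] pos[of "int n + 1"] by (simp add: add.commute)
  qed
  \<comment> \<open>For \<open>q ^ n\<close> below this threshold,
    \<open>a * q ^ j * y (- int n)\<close> exceeds 2.\<close>
  have "0 < a * q ^ j * c / 2" using a_pos q c by simp
  with lim have "\<forall>\<^sub>F n in sequentially. q ^ n < a * q ^ j * c / 2"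
    by (rule order_tendstoD)
  then obtain N where N: "\<And>n. n \<ge> N \<Longrightarrow> q ^ n < a * q ^ j * c / 2"
    by (auto simp: eventually_sequentially)
  show "summable (\<lambda>n. w (- int n) * y (- int n) ^ j)"
    unfolding u_def[symmetric]
  proof (rule summable_ratio_test)
    show "(1 / 2 :: real) < 1" by simp
    fix n assume "N \<le> n"
    let ?m = "- int (Suc n)"
    have "y ?m = c / q ^ Suc n"
      using q by (simp only: power_int_minus power_int_of_nat) (simp add: divide_inverse)
    moreover have "2 < a * q ^ j * c / q ^ Suc n"
      using N[of "Suc n"] \<open>N \<le> n\<close> q by (simp add: field_simps)
    ultimately have "2 < a * q ^ j * y ?m"
      by simp
    also have "\<dots> \<le> a * q ^ j * (1 + y ?m)"
      using a_pos q by (intro mult_left_mono) auto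
    finally have "2 * u ?m \<le> a * q ^ j * (1 + y ?m) * u ?m"
      using pos by (intro mult_right_mono less_imp_le) auto
    also have "\<dots> = u (- int n)"
      using rec[of ?m] by simp
    finally show "norm (u ?m) \<le> 1 / 2 * norm (u (- int n))"
      using pos[of ?m] pos[of "- int n"] by (simp only: real_norm_def abs_of_pos)
  qed
qed

section \<open>Moments of the weight\<close>

definition moment :: "nat \<Rightarrow> real" where
  "moment j = (\<Sum>\<^sub>\<infinity>k. w k * y k ^ j)"

text \<open>The term at \<open>k = 0\<close> is a positive lower bound; positivity of the total mass
  later permits normalisation.\<close>

lemma moment_0_pos: "0 < moment 0"
proof -
  have "w 0 = (\<Sum>\<^sub>\<infinity>k\<in>{0}. w k)" by simp
  also have "\<dots> \<le> moment 0"
    unfolding moment_def using weight_pos summable_on_weight_monomial[of 0]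
    by (intro infsum_mono_neutral) (auto simp: less_imp_le)
  finally show ?thesis using weight_pos[of 0] by linarith
qed

text \<open>The sum is invariant under the shift by 1, and the factor \<open>1 + y k\<close> of the
  shifted weight raises the power once:
  \<open>moment j = a * q ^ j * (moment j + moment (Suc j))\<close>.\<close>

lemma moment_Suc: "moment (Suc j) = moment j * (1 / (a * q ^ j) - 1)"
proof -
  have bij: "bij_betw (\<lambda>k::int. k + 1) UNIV UNIV"
    by (rule bij_betwI[of _ _ _ "\<lambda>k. k - 1"]) auto
  have "moment j = (\<Sum>\<^sub>\<infinity>k. w (k + 1) * y (k + 1) ^ j)"
    unfolding moment_def by (rule infsum_reindex_bij_betw[OF bij, symmetric])
  also have "\<dots> = (\<Sum>\<^sub>\<infinity>k. a * q ^ j * (w k * y k ^ j + w k * y k ^ Suc j))"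
    unfolding weight_monomial_Suc by (simp add: algebra_simps)
  also have "\<dots> = a * q ^ j * (moment j + moment (Suc j))"
    unfolding moment_def infsum_cmult_right'
    by (subst infsum_add) (auto intro: summable_on_weight_monomial simp del: power_Suc)
  finally show ?thesis
    using a_pos q by (simp add: field_simps)
qed

lemma moment_eq: "moment j * (a ^ j * q ^ (j choose 2)) = moment 0 * qpoch a q j"
proof (induction j)
  case (Suc j)
  have *: "Suc j choose 2 = j + (j choose 2)"
    by (simp add: numeral_2_eq_2)
  have "moment (Suc j) * (a ^ Suc j * q ^ (Suc j choose 2))
     = (1 - a * q ^ j) * (moment j * (a ^ j * q ^ (j choose 2)))"
    unfolding * moment_Suc using a_pos q by (simp add: power_add field_simps)
  then show ?case
    by (simp add: Suc qpoch_Suc)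
qed (simp add: numeral_2_eq_2)

end

section \<open>Orthogonality of the \<open>q\<close>-Laguerre polynomials\<close>

lemma real_choose_2: "real (k choose 2) = real k * (real k - 1) / 2"
  by (induction k) (simp_all add: numeral_2_eq_2 field_simps)

text \<open>The cross term turns the power \<open>q ^ (n * k)\<close> in \<open>coef n k\<close>
  into \<open>(q ^ k) ^ (n - m)\<close> when paired with the moment of order
  \<open>m + k\<close>.\<close>

lemma choose_2_add: "(m + k) choose 2 = (m choose 2) + (k choose 2) + m * k"
proof -
  have "real ((m + k) choose 2) = real ((m choose 2) + (k choose 2) + m * k)"
    by (simp add: real_choose_2 field_simps)
  then show ?thesis by linarith
qed

lemma has_sum_sum:
  fixes f :: "'a \<Rightarrow> 'b \<Rightarrow> 'c::topological_comm_monoid_add"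
  assumes "\<And>i. i \<in> I \<Longrightarrow> (f i has_sum s i) A"
  shows "((\<lambda>x. \<Sum>i\<in>I. f i x) has_sum (\<Sum>i\<in>I. s i)) A"
  using assms by (induction I rule: infinite_finite_induct) (auto intro: has_sum_add)

context q_Laguerre_weight
begin

text \<open>Everything that stands in front of the power sum in \<open>P q l n\<close>: the
  normalisation from \<open>P\<close> and the prefactor from \<open>qLaguerre\<close>.\<close>

definition norm_const :: "nat \<Rightarrow> real" where
  "norm_const n = q powr (real n / 2) * (sqrt (qpoch q q n) / sqrt (qpoch a q n))
     * (qpoch a q n / qpoch q q n)"

text \<open>The coefficient of \<open>y ^ k\<close> in \<open>P q l n\<close>. The real exponent k(n
  + \<alpha> + (k + 1)/2) equals nk + 2lk + (k choose 2) for \<alpha> = 2l - 1, hence the natural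
  powers of \<open>q\<close> and \<open>a\<close>.\<close>

definition coef :: "nat \<Rightarrow> nat \<Rightarrow> real" where
  "coef n k = norm_const n * (qbin_coeff q n k * q ^ (n * k) * (a ^ k * q ^ (k choose 2)) / qpoch a q k)"

lemma qpoch_q_pos: "0 < qpoch q q n" and qpoch_a_pos: "0 < qpoch a q n"
  using qpoch_pos q a_less_1 by auto

lemma norm_const_sq: "norm_const n * norm_const n = q ^ n * qpoch a q n / qpoch q q n"
proof -
  have "q powr (real n / 2) * q powr (real n / 2) = q ^ n"
    using q by (simp flip: powr_add powr_realpow)
  moreover have "(p * (sqrt A / sqrt B) * (B / A)) * (p * (sqrt A / sqrt B) * (B / A)) = p * p * B / A"
    if "0 < A" "0 < B" for p A B :: real
  proof -
    \<comment> \<open>In terms of the square roots the claim is a rational identity.\<close>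
    define s t where "s = sqrt A" and "t = sqrt B"
    have "A = s * s" "B = t * t" "0 < s" "0 < t"
      using that by (auto simp: s_def t_def)
    then show ?thesis
      unfolding s_def[symmetric] t_def[symmetric] by (simp add: field_simps)
  qed
  ultimately show ?thesis
    unfolding norm_const_def using qpoch_q_pos[of n] qpoch_a_pos[of n] by presburger
qed

lemma P_lam: "P q l n (lam q c k) = (\<Sum>j\<le>n. coef n j * y k ^ j)"
proof -
  have y: "2 * (1 - q) * lam q c k = y k"
    using q by (simp add: lam_def)
  have "qpoch (q powr (- real n)) q j * y k ^ j / (qpoch a q j * qpoch q q j)
      * q powr (real j * (real n + (2 * l - 1) + (real j + 1) / 2))
     = qbin_coeff q n j * q ^ (n * j) * (a ^ j * q ^ (j choose 2)) / qpoch a q j * y k ^ j" for j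
  proof -
    have "real j * (real n + (2 * l - 1) + (real j + 1) / 2)
        = real (n * j) + (2 * l * real j + real (j choose 2))"
      by (simp add: real_choose_2 field_simps)
    moreover have "a ^ j = q powr (2 * l * real j)"
      using q by (simp add: powr_powr flip: powr_realpow)
    ultimately have "q powr (real j * (real n + (2 * l - 1) + (real j + 1) / 2))
       = q ^ (n * j) * (a ^ j * q ^ (j choose 2))"
      using q by (simp only: powr_add powr_realpow)
    moreover have "q powr (- real n) = 1 / q ^ n"
      using q by (simp add: powr_minus powr_realpow divide_inverse)
    ultimately show ?thesis
      by (simp add: qbin_coeff_def mult_ac)
  qed
  then show ?thesis
    unfolding P_def qLaguerre_def y coef_def norm_const_def
    by (simp add: sum_distrib_left atLeast0AtMost mult.assoc)
qed

text \<open>The sum pairs \<open>P q l n\<close> with the power \<open>y ^ m\<close>. Splitting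
  \<open>qpoch a q (k + m)\<close> in the moment cancels the denominator of \<open>coef n k\<close>
  and leaves \<open>sum_qbin_coeff_qpoch\<close> with \<open>j = n - m\<close>.\<close>

lemma coef_sum_moment:
  assumes "m \<le> n"
  shows "(\<Sum>k\<le>n. coef n k * moment (m + k)) * (a ^ m * q ^ (m choose 2))
    = (if m = n then moment 0 * norm_const n * qpoch (1 / q ^ n) q n else 0)"
proof -
  have "coef n k * moment (m + k) * (a ^ m * q ^ (m choose 2))
     = moment 0 * norm_const n * (qbin_coeff q n k * (q ^ k) ^ (n - m) * qpoch (a * q ^ k) q m)" for k
  proof -
    have 1: "moment 0 * (qpoch a q k * qpoch (a * q ^ k) q m)
       = moment (m + k) * ((a ^ m * q ^ (m choose 2)) * (a ^ k * q ^ (k choose 2)) * q ^ (m * k))"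
      using moment_eq[of "m + k"] qpoch_add[of a q k m]
      by (simp add: choose_2_add power_add add.commute[of m k] mult_ac)
    have 2: "q ^ (n * k) = q ^ (m * k) * (q ^ k) ^ (n - m)"
      using assms by (simp flip: power_mult power_add add: algebra_simps)
    have "coef n k * moment (m + k) * (a ^ m * q ^ (m choose 2))
       = norm_const n * qbin_coeff q n k * (q ^ k) ^ (n - m) / qpoch a q k
         * (moment (m + k) * ((a ^ m * q ^ (m choose 2)) * (a ^ k * q ^ (k choose 2)) * q ^ (m * k)))"
      unfolding coef_def 2 by simp
    also have "\<dots> = moment 0 * norm_const n
        * (qbin_coeff q n k * (q ^ k) ^ (n - m) * qpoch (a * q ^ k) q m)"
      unfolding 1[symmetric] using qpoch_a_pos[of k] by simp
    finally show ?thesis .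
  qed
  then have "(\<Sum>k\<le>n. coef n k * moment (m + k)) * (a ^ m * q ^ (m choose 2))
     = moment 0 * norm_const n
       * (\<Sum>k\<le>n. qbin_coeff q n k * (q ^ k) ^ (n - m) * qpoch (a * q ^ k) q m)"
    by (simp add: sum_distrib_right sum_distrib_left)
  also have "\<dots> = (if m = n then moment 0 * norm_const n * qpoch (1 / q ^ n) q n else 0)"
    using assms q by (subst sum_qbin_coeff_qpoch) auto
  finally show ?thesis .
qed

text \<open>\<open>P q l m\<close> involves only powers below \<open>n\<close>, each of which pairs
  to zero with \<open>P q l n\<close>.\<close>

lemma coef_double_sum_moment_less:
  assumes "m < n"
  shows "(\<Sum>i\<le>m. \<Sum>j\<le>n. coef m i * coef n j * moment (i + j)) = 0"
proof (rule sum.neutral, rule ballI)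
  fix i assume "i \<in> {..m}"
  then have "(\<Sum>j\<le>n. coef n j * moment (i + j)) = 0"
    using coef_sum_moment[of i n] assms a_pos q by simp
  then show "(\<Sum>j\<le>n. coef m i * coef n j * moment (i + j)) = 0"
    by (simp add: mult.assoc flip: sum_distrib_left)
qed

text \<open>Only the top power contributes. The factor \<open>q ^ n\<close> in
  \<open>norm_const_sq\<close> cancels the remaining power of \<open>q\<close>, which makes the norm
  independent of \<open>n\<close>.\<close>

lemma coef_double_sum_moment_eq:
  "(\<Sum>i\<le>n. \<Sum>j\<le>n. coef n i * coef n j * moment (i + j)) = moment 0"
proof -
  let ?S = "\<lambda>i. \<Sum>j\<le>n. coef n j * moment (i + j)"
  let ?Q = "qpoch (1 / q ^ n) q n"
  have S0: "?S i = 0" if "i < n" for i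
    using coef_sum_moment[of i n] that a_pos q by simp
  have Sn: "?S n * (a ^ n * q ^ (n choose 2)) = moment 0 * norm_const n * ?Q"
    using coef_sum_moment[of n n] by simp
  have "(\<Sum>i\<le>n. \<Sum>j\<le>n. coef n i * coef n j * moment (i + j)) = (\<Sum>i\<le>n. coef n i * ?S i)"
    by (simp add: mult.assoc sum_distrib_left)
  also have "\<dots> = (\<Sum>i\<in>{n}. coef n i * ?S i)"
    by (rule sum.mono_neutral_right) (auto simp: S0)
  also have "\<dots> = coef n n * ?S n"
    by simp
  also have "\<dots> = norm_const n * qbin_coeff q n n * q ^ (n * n) / qpoch a q n
      * (?S n * (a ^ n * q ^ (n choose 2)))"
    by (simp add: coef_def)
  \<comment> \<open>One \<open>?Q\<close> comes from the leading coefficient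
    \<open>qbin_coeff q n n\<close>, the other from \<open>Sn\<close>.\<close>
  also have "\<dots> = moment 0 * (norm_const n * norm_const n) * (?Q * ?Q * q ^ (n * n))
      / (qpoch q q n * qpoch a q n)"
    unfolding Sn qbin_coeff_def by simp
  finally have *: "(\<Sum>i\<le>n. \<Sum>j\<le>n. coef n i * coef n j * moment (i + j)) =
    moment 0 * (norm_const n * norm_const n) * (?Q * ?Q * q ^ (n * n))
      / (qpoch q q n * qpoch a q n)" .
  \<comment> \<open>Since n^2 + n = 2((n choose 2) + n), the power of \<open>q\<close> is shared
    evenly by two copies of \<open>qpoch_neg_power\<close>.\<close>
  have "?Q * ?Q * q ^ (n * n) * q ^ n = qpoch q q n * qpoch q q n"
  proof -
    have "n * n = 2 * (n choose 2) + n"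
    proof -
      have "real (n * n) = real (2 * (n choose 2) + n)"
        by (simp add: real_choose_2 field_simps)
      then show ?thesis by linarith
    qed
    then have "?Q * ?Q * q ^ (n * n) * q ^ n
        = (?Q * q ^ (n choose 2) * q ^ n) * (?Q * q ^ (n choose 2) * q ^ n)"
      by (simp add: power_add mult_2 mult_ac)
    then show ?thesis
      using q by (simp add: qpoch_neg_power mult.left_commute flip: power_add mult_2 mult.assoc)
  qed
  then have "?Q * ?Q * q ^ (n * n) = qpoch q q n * qpoch q q n / q ^ n"
    using q by (simp add: field_simps)
  then show ?thesis
    unfolding * norm_const_sq using q qpoch_q_pos[of n] qpoch_a_pos[of n] by simp
qed

lemma coef_double_sum_moment:
  "(\<Sum>i\<le>m. \<Sum>j\<le>n. coef m i * coef n j * moment (i + j)) = (if m = n then moment 0 else 0)"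
proof (cases m n rule: linorder_cases)
  case greater
  have "(\<Sum>i\<le>m. \<Sum>j\<le>n. coef m i * coef n j * moment (i + j))
     = (\<Sum>j\<le>n. \<Sum>i\<le>m. coef n j * coef m i * moment (j + i))"
    by (subst sum.swap) (simp add: mult_ac add_ac)
  then show ?thesis
    using greater coef_double_sum_moment_less by simp
qed (auto simp: coef_double_sum_moment_less coef_double_sum_moment_eq)

text \<open>The product is a finite combination of monomials, so convergence and value follow
  termwise from the moments.\<close>

lemma has_sum_P_product:
  "((\<lambda>k. w k * (P q l m (lam q c k) * P q l n (lam q c k)))
      has_sum (if m = n then moment 0 else 0)) UNIV"
proof -
  have "((\<lambda>k. w k * y k ^ j) has_sum moment j) UNIV" for j
    unfolding moment_def by (intro has_sum_infsum summable_on_weight_monomial)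
  then have "((\<lambda>k. \<Sum>i\<le>m. \<Sum>j\<le>n. coef m i * coef n j * (w k * y k ^ (i + j)))
      has_sum (\<Sum>i\<le>m. \<Sum>j\<le>n. coef m i * coef n j * moment (i + j))) UNIV"
    by (intro has_sum_sum has_sum_cmult_right) auto
  moreover have "(\<Sum>i\<le>m. \<Sum>j\<le>n. coef m i * coef n j * (w k * y k ^ (i + j)))
      = w k * (P q l m (lam q c k) * P q l n (lam q c k))" for k
    unfolding P_lam sum_product by (simp add: sum_distrib_left power_add mult_ac)
  ultimately show ?thesis
    by (simp add: coef_double_sum_moment)
qed

end

section \<open>Weighted sequence spaces\<close>

lemma cscale_apply: "(z *\<^sub>c x) k = z * x k"
  by (simp add: cscale_def)

lemma ip_norm_less_iff:
  assumes "0 < e"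
  shows "ip_norm ip a < e \<longleftrightarrow> Re (ip a a) < e\<^sup>2"
proof -
  have "sqrt (e\<^sup>2) = e" using assms by simp
  then show ?thesis
    unfolding ip_norm_def by (metis real_sqrt_less_iff)
qed

lemma inner_product_on_subset:
  assumes "inner_product_on ip L" "cseq.subspace H" "H \<subseteq> L"
  shows "inner_product_on ip H"
  unfolding inner_product_on_def
proof (intro conjI assms(2))
  note ip = assms(1)[unfolded inner_product_on_def]
  show "\<forall>x\<in>H. \<forall>y\<in>H. \<forall>z\<in>H. ip (x + y) z = ip x z + ip y z"
    using ip[THEN conjunct2, THEN conjunct1] assms(3) by blast
  show "\<forall>x\<in>H. \<forall>y\<in>H. \<forall>z. ip (z *\<^sub>c x) y = z * ip x y"
    using ip[THEN conjunct2, THEN conjunct2, THEN conjunct1] assms(3) by blast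
  show "\<forall>x\<in>H. \<forall>y\<in>H. ip y x = cnj (ip x y)"
    using ip[THEN conjunct2, THEN conjunct2, THEN conjunct2, THEN conjunct1] assms(3) by blast
  show "\<forall>x\<in>H. x \<noteq> 0 \<longrightarrow> 0 < Re (ip x x)"
    using ip[THEN conjunct2, THEN conjunct2, THEN conjunct2, THEN conjunct2] assms(3) by blast
qed

text \<open>The real and the complex family are summable together; otherwise both sums have the
  default value 0.\<close>

lemma infsum_complex_of_real:
  "(\<Sum>\<^sub>\<infinity>x\<in>A. complex_of_real (f x)) = complex_of_real (\<Sum>\<^sub>\<infinity>x\<in>A. f x)"
proof -
  have "(\<lambda>x. complex_of_real (f x)) summable_on A \<longleftrightarrow> f summable_on A"
    using summable_on_Re[of "\<lambda>x. complex_of_real (f x)" A] summable_on_of_real by auto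
  then show ?thesis
    by (rule infsum_bounded_linear_strong[where h = complex_of_real, OF _ bounded_linear_of_real])
qed

locale weighted_l2 =
  fixes w :: "int \<Rightarrow> real" and b :: real
  assumes w_pos: "\<And>k. 0 < w k" and b_pos: "0 < b"
begin

definition L2 :: "cseq set" where
  "L2 = {x. (\<lambda>k. w k * (cmod (x k))\<^sup>2) summable_on UNIV}"

definition ip :: form where
  "ip x y = complex_of_real b * (\<Sum>\<^sub>\<infinity>k. complex_of_real (w k) * x k * cnj (y k))"

text \<open>The square of \<open>ip_norm\<close> as a real number, so that estimates avoid square
  roots.\<close>

definition sqn :: "cseq \<Rightarrow> real" where
  "sqn x = b * (\<Sum>\<^sub>\<infinity>k. w k * (cmod (x k))\<^sup>2)"

lemma w_nonneg [simp]: "0 \<le> w k"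
  using w_pos less_imp_le by blast

lemma L2D: "x \<in> L2 \<Longrightarrow> (\<lambda>k. w k * (cmod (x k))\<^sup>2) summable_on UNIV"
  by (simp add: L2_def)

text \<open>Absolute summability by comparison, from 2uv \<le> u^2 + v^2.\<close>

lemma L2_product:
  assumes "x \<in> L2" "y \<in> L2"
  shows "(\<lambda>k. complex_of_real (w k) * x k * cnj (y k)) summable_on UNIV"
proof (rule abs_summable_summable, rule Infinite_Sum.abs_summable_on_comparison_test')
  show "(\<lambda>k. w k * (cmod (x k))\<^sup>2 + w k * (cmod (y k))\<^sup>2) summable_on UNIV"
    using assms by (intro summable_on_add L2D)
  fix k
  have "cmod (x k) * cmod (y k) \<le> (cmod (x k))\<^sup>2 + (cmod (y k))\<^sup>2"
    using sum_squares_bound[of "cmod (x k)" "cmod (y k)"]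
      mult_nonneg_nonneg[of "cmod (x k)" "cmod (y k)"] norm_ge_zero[of "x k"] norm_ge_zero[of "y k"]
    by linarith
  then have "w k * (cmod (x k) * cmod (y k)) \<le> w k * ((cmod (x k))\<^sup>2 + (cmod (y k))\<^sup>2)"
    by (intro mult_left_mono) auto
  then show "norm (complex_of_real (w k) * x k * cnj (y k))
      \<le> w k * (cmod (x k))\<^sup>2 + w k * (cmod (y k))\<^sup>2"
    by (simp add: norm_mult distrib_left mult.assoc)
qed

text \<open>The factor \<open>2\<close> replaces the triangle inequality for the norm: it is all that closures and
  limits need.\<close>

lemma cmod_add_sq: "(cmod (u + v))\<^sup>2 \<le> 2 * (cmod u)\<^sup>2 + 2 * (cmod v)\<^sup>2"
proof -
  have "(cmod (u + v))\<^sup>2 \<le> (cmod u + cmod v)\<^sup>2"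
    by (intro power_mono norm_triangle_ineq) auto
  also have "\<dots> \<le> 2 * (cmod u)\<^sup>2 + 2 * (cmod v)\<^sup>2"
    using sum_squares_bound[of "cmod u" "cmod v"] by (simp add: power2_sum)
  finally show ?thesis .
qed

lemma w_cmod_add_sq:
  "w k * (cmod (u + v))\<^sup>2 \<le> 2 * (w k * (cmod u)\<^sup>2) + 2 * (w k * (cmod v)\<^sup>2)"
  using mult_left_mono[OF cmod_add_sq[of u v] w_nonneg[of k]] by (simp add: distrib_left)

lemma L2_add:
  assumes "x \<in> L2" "y \<in> L2"
  shows "x + y \<in> L2"
  unfolding L2_def mem_Collect_eq
proof (rule summable_on_comparison_test)
  show "(\<lambda>k. 2 * (w k * (cmod (x k))\<^sup>2) + 2 * (w k * (cmod (y k))\<^sup>2)) summable_on UNIV"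
    using assms by (intro summable_on_add summable_on_cmult_right L2D)
qed (auto intro: w_cmod_add_sq)

lemma L2_scale:
  assumes "x \<in> L2"
  shows "z *\<^sub>c x \<in> L2"
proof -
  have "w k * (cmod ((z *\<^sub>c x) k))\<^sup>2 = (cmod z)\<^sup>2 * (w k * (cmod (x k))\<^sup>2)" for k
    by (simp add: cscale_apply norm_mult power_mult_distrib)
  then show ?thesis
    unfolding L2_def mem_Collect_eq using summable_on_cmult_right[OF L2D[OF assms]] by presburger
qed

lemma subspace_L2: "cseq.subspace L2"
proof (rule cseq.subspaceI)
  show "0 \<in> L2" by (simp add: L2_def)
qed (auto intro: L2_add L2_scale)

lemma L2_diff: "x \<in> L2 \<Longrightarrow> y \<in> L2 \<Longrightarrow> x - y \<in> L2"
  by (rule cseq.subspace_diff[OF subspace_L2])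

lemma ip_self: "ip x x = complex_of_real (sqn x)"
proof -
  have "complex_of_real (w k) * x k * cnj (x k) = complex_of_real (w k * (cmod (x k))\<^sup>2)" for k
    by (simp only: of_real_mult complex_norm_square mult.assoc)
  then have "ip x x = complex_of_real b * (\<Sum>\<^sub>\<infinity>k. complex_of_real (w k * (cmod (x k))\<^sup>2))"
    by (simp only: ip_def)
  then show ?thesis
    unfolding infsum_complex_of_real sqn_def by simp
qed

lemma sqn_pos:
  assumes "x \<in> L2" "x \<noteq> 0"
  shows "0 < sqn x"
proof -
  obtain k where k: "x k \<noteq> 0" using assms(2) by (auto simp: fun_eq_iff)
  have "0 < w k * (cmod (x k))\<^sup>2"
    using w_pos k by simp
  also have "\<dots> = (\<Sum>\<^sub>\<infinity>k\<in>{k}. w k * (cmod (x k))\<^sup>2)"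
    by simp
  also have "\<dots> \<le> (\<Sum>\<^sub>\<infinity>k. w k * (cmod (x k))\<^sup>2)"
    using L2D[OF assms(1)] by (intro infsum_mono_neutral) auto
  finally show ?thesis
    using b_pos by (simp add: sqn_def)
qed

lemma sqn_add:
  assumes "x \<in> L2" "y \<in> L2"
  shows "sqn (x + y) \<le> 2 * sqn x + 2 * sqn y"
proof -
  have "(\<Sum>\<^sub>\<infinity>k. w k * (cmod ((x + y) k))\<^sup>2)
      \<le> (\<Sum>\<^sub>\<infinity>k. 2 * (w k * (cmod (x k))\<^sup>2) + 2 * (w k * (cmod (y k))\<^sup>2))"
    using assms
    by (intro infsum_mono summable_on_add summable_on_cmult_right L2D L2_add)
       (simp_all add: w_cmod_add_sq)
  also have "\<dots> = 2 * (\<Sum>\<^sub>\<infinity>k. w k * (cmod (x k))\<^sup>2) + 2 * (\<Sum>\<^sub>\<infinity>k. w k * (cmod (y k))\<^sup>2)"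
    using assms by (subst infsum_add) (auto intro!: summable_on_cmult_right L2D simp: infsum_cmult_right')
  finally have "sqn (x + y) \<le> b * (2 * (\<Sum>\<^sub>\<infinity>k. w k * (cmod (x k))\<^sup>2)
      + 2 * (\<Sum>\<^sub>\<infinity>k. w k * (cmod (y k))\<^sup>2))"
    unfolding sqn_def using b_pos by (intro mult_left_mono) auto
  then show ?thesis
    unfolding sqn_def by (simp only: distrib_left mult.left_commute[of b 2])
qed

lemma inner_product_L2: "inner_product_on ip L2"
  unfolding inner_product_on_def
proof (intro conjI ballI allI impI)
  show "cseq.subspace L2" by (rule subspace_L2)
next
  fix x y z assume "x \<in> L2" "y \<in> L2" "z \<in> L2"
  then have "(\<Sum>\<^sub>\<infinity>k. complex_of_real (w k) * x k * cnj (z k) + complex_of_real (w k) * y k * cnj (z k))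
     = (\<Sum>\<^sub>\<infinity>k. complex_of_real (w k) * x k * cnj (z k)) + (\<Sum>\<^sub>\<infinity>k. complex_of_real (w k) * y k * cnj (z k))"
    by (intro infsum_add L2_product)
  then show "ip (x + y) z = ip x z + ip y z"
    by (simp add: ip_def distrib_left distrib_right)
next
  fix x y z
  show "ip (z *\<^sub>c x) y = z * ip x y"
  proof -
    have "complex_of_real (w k) * (z *\<^sub>c x) k * cnj (y k) = z * (complex_of_real (w k) * x k * cnj (y k))" for k
      by (simp add: cscale_apply)
    then show ?thesis
      unfolding ip_def by (simp only: infsum_cmult_right') simp
  qed
next
  fix x y
  have "complex_of_real (w k) * y k * cnj (x k) = cnj (complex_of_real (w k) * x k * cnj (y k))" for k
    by simp
  then show "ip y x = cnj (ip x y)"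
    unfolding ip_def by (simp only: infsum_cnj) simp
next
  fix x assume "x \<in> L2" "x \<noteq> 0"
  then show "0 < Re (ip x x)"
    by (simp add: ip_self sqn_pos)
qed

section \<open>Completeness of the weighted space\<close>

lemma ip_norm_less: "0 < e \<Longrightarrow> ip_norm ip x < e \<longleftrightarrow> sqn x < e\<^sup>2"
  by (simp add: ip_norm_less_iff ip_self)

lemma sqn_commute: "sqn (x - y) = sqn (y - x)"
  by (simp add: sqn_def norm_minus_commute)

lemma sqn_nonneg: "0 \<le> sqn x"
  unfolding sqn_def using b_pos by (intro mult_nonneg_nonneg infsum_nonneg) auto

lemma sum_le_sqn:
  assumes "x \<in> L2" "finite F"
  shows "b * (\<Sum>k\<in>F. w k * (cmod (x k))\<^sup>2) \<le> sqn x"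
  using assms b_pos unfolding sqn_def
  by (intro mult_left_mono finite_sum_le_infsum L2D) auto

text \<open>Positive weights make every coordinate converge. Letting \<open>n\<close> tend to
  infinity in finite partial sums of the Cauchy estimate gives a bound independent of the finite
  set, hence membership and convergence in norm.\<close>

lemma complete_L2:
  assumes X: "\<And>n. X n \<in> L2"
    and Cauchy: "\<And>e. 0 < e \<Longrightarrow> \<exists>N. \<forall>m\<ge>N. \<forall>n\<ge>N. sqn (X m - X n) < e"
  obtains x where "x \<in> L2" "(\<lambda>n. sqn (X n - x)) \<longlonglongrightarrow> 0"
proof -
  have X_diff: "X m - X n \<in> L2" for m n
    using X L2_diff by blast
  have "Cauchy (\<lambda>n. X n k)" for k
  proof (rule CauchyI)
    fix e :: real assume e: "0 < e"
    \<comment> \<open>The squared coordinate times \<open>b * w k\<close> is one term of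
      \<open>sqn\<close>, so this bound forces the coordinates within \<open>e\<close>.\<close>
    then have "0 < b * w k * e\<^sup>2" using b_pos w_pos by simp
    then obtain N where N: "\<And>m n. m \<ge> N \<Longrightarrow> n \<ge> N \<Longrightarrow> sqn (X m - X n) < b * w k * e\<^sup>2"
      using Cauchy by meson
    have "norm (X m k - X n k) < e" if "m \<ge> N" "n \<ge> N" for m n
    proof -
      have "b * w k * (cmod (X m k - X n k))\<^sup>2 < b * w k * e\<^sup>2"
        using sum_le_sqn[OF X_diff[of m n], of "{k}"] N[OF that] by simp
      then have "(cmod (X m k - X n k))\<^sup>2 < e\<^sup>2"
        using b_pos w_pos[of k] by simp
      then show ?thesis
        using e by (simp add: power2_less_imp_less)
    qed
    then show "\<exists>M. \<forall>m\<ge>M. \<forall>n\<ge>M. norm (X m k - X n k) < e" by blast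
  qed
  then have "\<forall>k. \<exists>z. (\<lambda>n. X n k) \<longlonglongrightarrow> z"
    using Cauchy_convergent_iff convergent_def by blast
  then obtain x where x: "\<And>k. (\<lambda>n. X n k) \<longlonglongrightarrow> x k"
    by metis
  have key: "\<exists>N. \<forall>m\<ge>N. X m - x \<in> L2 \<and> sqn (X m - x) \<le> e" if "0 < e" for e
  proof -
    obtain N where N: "\<And>m n. m \<ge> N \<Longrightarrow> n \<ge> N \<Longrightarrow> sqn (X m - X n) < e"
      using Cauchy \<open>0 < e\<close> by meson
    have "X m - x \<in> L2 \<and> sqn (X m - x) \<le> e" if m: "m \<ge> N" for m
    proof -
      have fin: "(\<Sum>k\<in>F. w k * (cmod ((X m - x) k))\<^sup>2) \<le> e / b" if "finite F" for F
      proof (rule LIMSEQ_le_const2)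
        show "(\<lambda>n. \<Sum>k\<in>F. w k * (cmod (X m k - X n k))\<^sup>2)
            \<longlonglongrightarrow> (\<Sum>k\<in>F. w k * (cmod ((X m - x) k))\<^sup>2)"
          unfolding minus_apply by (intro tendsto_intros x)
        have "(\<Sum>k\<in>F. w k * (cmod (X m k - X n k))\<^sup>2) \<le> e / b" if "n \<ge> N" for n
          using sum_le_sqn[OF X_diff[of m n] \<open>finite F\<close>] N[OF m that] b_pos
          by (simp add: field_simps)
        then show "\<exists>N. \<forall>n\<ge>N. (\<Sum>k\<in>F. w k * (cmod (X m k - X n k))\<^sup>2) \<le> e / b"
          by blast
      qed
      then have "X m - x \<in> L2"
        unfolding L2_def mem_Collect_eq
        by (intro nonneg_bounded_partial_sums_imp_summable_on[where C = "e / b"]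
            eventually_finite_subsets_at_top_weakI) auto
      moreover from this have "(\<Sum>\<^sub>\<infinity>k. w k * (cmod ((X m - x) k))\<^sup>2) \<le> e / b"
        using fin by (intro infsum_le_finite_sums L2D)
      then have "sqn (X m - x) \<le> e"
        using b_pos by (simp add: sqn_def field_simps)
      ultimately show ?thesis ..
    qed
    then show ?thesis by blast
  qed
  show ?thesis
  proof
    \<comment> \<open>\<open>x\<close> is the difference of the two members \<open>X m\<close> and
      \<open>X m - x\<close>.\<close>
    obtain m where "X m - x \<in> L2" using key[of 1] by auto
    then have "X m - (X m - x) \<in> L2"
      using X L2_diff by blast
    then show "x \<in> L2" by simp
    show "(\<lambda>n. sqn (X n - x)) \<longlonglongrightarrow> 0"
    proof (rule LIMSEQ_I)
      fix e :: real assume "0 < e"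
      then obtain N where "\<forall>m\<ge>N. sqn (X m - x) \<le> e / 2"
        using key[of "e / 2"] by auto
      then have "\<forall>n\<ge>N. norm (sqn (X n - x) - 0) < e"
        using \<open>0 < e\<close> sqn_nonneg by fastforce
      then show "\<exists>N. \<forall>n\<ge>N. norm (sqn (X n - x) - 0) < e" ..
    qed
  qed
qed

section \<open>Closures of subspaces\<close>

lemma closure_in_L2_iff:
  "x \<in> closure_in ip L2 S \<longleftrightarrow> x \<in> L2 \<and> (\<forall>e>0. \<exists>s\<in>S. sqn (x - s) < e)"
proof -
  have "(\<forall>e>0. \<exists>s\<in>S. sqn (x - s) < e\<^sup>2) \<longleftrightarrow> (\<forall>e>0. \<exists>s\<in>S. sqn (x - s) < e)"
  proof safe
    fix e :: real assume "\<forall>e>0. \<exists>s\<in>S. sqn (x - s) < e\<^sup>2" "0 < e"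
    then show "\<exists>s\<in>S. sqn (x - s) < e"
      by (elim allE[of _ "sqrt e"]) simp
  qed simp
  then show ?thesis
    by (auto simp: closure_in_def ip_norm_less)
qed

lemma subset_closure_in_L2:
  assumes "S \<subseteq> L2"
  shows "S \<subseteq> closure_in ip L2 S"
proof
  fix x assume "x \<in> S"
  then show "x \<in> closure_in ip L2 S"
    using assms unfolding closure_in_L2_iff by (auto intro!: bexI[of _ x] simp: sqn_def)
qed

lemma sqn_diff_triangle:
  assumes "x \<in> L2" "y \<in> L2" "z \<in> L2"
  shows "sqn (x - z) \<le> 2 * sqn (x - y) + 2 * sqn (y - z)"
  using sqn_add[of "x - y" "y - z"] assms by (simp add: L2_diff)

lemma subspace_closure_in_L2:
  assumes S: "cseq.subspace S" "S \<subseteq> L2"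
  shows "cseq.subspace (closure_in ip L2 S)"
proof (rule cseq.subspaceI)
  show "0 \<in> closure_in ip L2 S"
    using subset_closure_in_L2[OF S(2)] cseq.subspace_0[OF S(1)] by blast
next
  fix x y assume xy: "x \<in> closure_in ip L2 S" "y \<in> closure_in ip L2 S"
  show "x + y \<in> closure_in ip L2 S"
    unfolding closure_in_L2_iff
  proof (intro conjI allI impI)
    show "x + y \<in> L2" using xy by (auto simp: closure_in_L2_iff L2_add)
    fix e :: real assume "0 < e"
    \<comment> \<open>Two errors below \<open>e / 4\<close>, each doubled by \<open>sqn_add\<close>,
      stay below \<open>e\<close> in total.\<close>
    then have "0 < e / 4" by simp
    then obtain s t where st: "s \<in> S" "t \<in> S" "sqn (x - s) < e / 4" "sqn (y - t) < e / 4"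
      using xy unfolding closure_in_L2_iff by meson
    have "sqn (x + y - (s + t)) = sqn ((x - s) + (y - t))"
      by (simp add: algebra_simps)
    also have "\<dots> \<le> 2 * sqn (x - s) + 2 * sqn (y - t)"
      using xy st S by (intro sqn_add L2_diff) (auto simp: closure_in_L2_iff)
    also have "\<dots> < e" using st by simp
    finally show "\<exists>s\<in>S. sqn (x + y - s) < e"
      using cseq.subspace_add[OF S(1) st(1,2)] by blast
  qed
next
  fix x z assume x: "x \<in> closure_in ip L2 S"
  show "z *\<^sub>c x \<in> closure_in ip L2 S"
    unfolding closure_in_L2_iff
  proof (intro conjI allI impI)
    show "z *\<^sub>c x \<in> L2" using x by (auto simp: closure_in_L2_iff L2_scale)
    fix e :: real assume "0 < e"
    \<comment> \<open>Adding 1 keeps the divisor positive for \<open>z = 0\<close>.\<close>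
    moreover have pos: "0 < (cmod z)\<^sup>2 + 1"
      by (intro add_nonneg_pos) auto
    ultimately have "0 < e / ((cmod z)\<^sup>2 + 1)" by simp
    then obtain s where s: "s \<in> S" "sqn (x - s) < e / ((cmod z)\<^sup>2 + 1)"
      using x unfolding closure_in_L2_iff by meson
    have "w k * (cmod ((z *\<^sub>c x - z *\<^sub>c s) k))\<^sup>2 = (cmod z)\<^sup>2 * (w k * (cmod ((x - s) k))\<^sup>2)" for k
      by (simp add: cscale_apply norm_mult power_mult_distrib flip: right_diff_distrib)
    then have "sqn (z *\<^sub>c x - z *\<^sub>c s) = (cmod z)\<^sup>2 * sqn (x - s)"
      unfolding sqn_def by (simp only: infsum_cmult_right') simp
    also have "\<dots> \<le> ((cmod z)\<^sup>2 + 1) * sqn (x - s)"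
      using sqn_nonneg[of "x - s"] by (intro mult_right_mono) auto
    also have "\<dots> < e" using s pos by (simp add: field_simps)
    finally show "\<exists>s\<in>S. sqn (z *\<^sub>c x - s) < e"
      using cseq.subspace_scale[OF S(1) s(1)] by blast
  qed
qed

text \<open>Completeness of \<open>L2\<close> supplies the limit; an element of \<open>S\<close>
  close to a late \<open>X n\<close> is close to the limit, which therefore lies in the
  closure.\<close>

lemma hilbert_space_closure_in_L2:
  assumes S: "cseq.subspace S" "S \<subseteq> L2"
  shows "hilbert_space_on ip (closure_in ip L2 S)"
  unfolding hilbert_space_on_def
proof (intro conjI allI impI)
  let ?H = "closure_in ip L2 S"
  have HL: "?H \<subseteq> L2" by (auto simp: closure_in_def)
  then show "inner_product_on ip ?H"
    using inner_product_on_subset inner_product_L2 subspace_closure_in_L2[OF S] by blast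
  fix X :: "nat \<Rightarrow> cseq"
  assume "(\<forall>n. X n \<in> ?H) \<and> (\<forall>e>0. \<exists>N. \<forall>m\<ge>N. \<forall>n\<ge>N. ip_norm ip (X m - X n) < e)"
  then have X: "\<forall>n. X n \<in> ?H"
    and C: "\<forall>e>0. \<exists>N. \<forall>m\<ge>N. \<forall>n\<ge>N. ip_norm ip (X m - X n) < e"
    by auto
  have XL: "X n \<in> L2" for n using X HL by blast
  have C': "\<exists>N. \<forall>m\<ge>N. \<forall>n\<ge>N. sqn (X m - X n) < e" if "0 < e" for e
    using C[rule_format, of "sqrt e"] that by (simp add: ip_norm_less)
  obtain x where x: "x \<in> L2" "(\<lambda>n. sqn (X n - x)) \<longlonglongrightarrow> 0"
    using complete_L2[of X, OF XL C'] by blast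
  have "x \<in> ?H"
    unfolding closure_in_L2_iff
  proof (intro conjI allI impI x(1))
    fix e :: real assume "0 < e"
    then have e: "0 < e / 4" by simp
    then obtain n where n: "sqn (X n - x) < e / 4"
      using order_tendstoD(2)[OF x(2) e] by (auto simp: eventually_sequentially)
    obtain s where s: "s \<in> S" "sqn (X n - s) < e / 4"
      using X e unfolding closure_in_L2_iff by meson
    have "sqn (x - s) \<le> 2 * sqn (x - X n) + 2 * sqn (X n - s)"
      using S s x XL by (intro sqn_diff_triangle) auto
    also have "\<dots> < e" using n s by (simp add: sqn_commute[of x])
    finally show "\<exists>s\<in>S. sqn (x - s) < e" using s by blast
  qed
  moreover have "(\<lambda>n. ip_norm ip (X n - x)) \<longlonglongrightarrow> 0"
    unfolding ip_norm_def ip_self using tendsto_real_sqrt[OF x(2)] by simp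
  ultimately show "\<exists>x\<in>?H. (\<lambda>n. ip_norm ip (X n - x)) \<longlonglongrightarrow> 0" by blast
qed

end

section \<open>The discrete series on an orthonormal family\<close>

abbreviation cseq_linear :: "(cseq \<Rightarrow> cseq) \<Rightarrow> bool" where
  "cseq_linear \<equiv> Vector_Spaces.linear cscale cscale"

interpretation cseq_pair: vector_space_pair cscale cscale ..

lemma cseq_linear_simps:
  assumes "cseq_linear T"
  shows "T (x + y) = T x + T y" "T (z *\<^sub>c x) = z *\<^sub>c T x" "T (\<Sum>i\<in>S. g i) = (\<Sum>i\<in>S. T (g i))" "T 0 = 0"
proof -
  interpret T: Vector_Spaces.linear cscale cscale T by fact
  show "T (x + y) = T x + T y" "T (z *\<^sub>c x) = z *\<^sub>c T x" "T (\<Sum>i\<in>S. g i) = (\<Sum>i\<in>S. T (g i))" "T 0 = 0"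
    by (rule T.add T.scale T.sum T.zero)+
qed

text \<open>With linear commutators, the defining relations can be checked on basis vectors.\<close>

lemma cseq_linear_comp_diff:
  assumes "cseq_linear A" "cseq_linear B"
  shows "cseq_linear (\<lambda>x. A (B x) - B (A x))"
  using cseq_pair.linear_compose_sub[OF Vector_Spaces.linear_compose[OF assms(2,1)]
      Vector_Spaces.linear_compose[OF assms]]
  by (simp add: o_def)

section \<open>Linear algebra on the span of an orthonormal family\<close>

locale orthonormal_family =
  fixes ip :: form and H :: "cseq set" and f :: "nat \<Rightarrow> cseq"
  assumes inner_product: "inner_product_on ip H"
    and in_H: "f n \<in> H"
    and orthonormal: "ip (f m) (f n) = (if m = n then 1 else 0)"
begin

abbreviation "D \<equiv> cseq.span (range f)"

lemma subspace_H: "cseq.subspace H"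
  using inner_product by (simp add: inner_product_on_def)

lemma D_subset_H: "D \<subseteq> H"
  using in_H by (intro cseq.span_minimal subspace_H) auto

lemma f_in_D: "f n \<in> D"
  by (simp add: cseq.span_base)

lemma ip_add_left: "x \<in> H \<Longrightarrow> y \<in> H \<Longrightarrow> z \<in> H \<Longrightarrow> ip (x + y) z = ip x z + ip y z"
  and ip_scale_left: "x \<in> H \<Longrightarrow> y \<in> H \<Longrightarrow> ip (w *\<^sub>c x) y = w * ip x y"
  and ip_cnj: "x \<in> H \<Longrightarrow> y \<in> H \<Longrightarrow> cnj (ip x y) = ip y x"
  using inner_product unfolding inner_product_on_def by metis+

lemma ip_0_left: "y \<in> H \<Longrightarrow> ip 0 y = 0"
  using ip_scale_left[OF cseq.subspace_0[OF subspace_H], of y 0] by simp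

lemma ip_sum_left:
  assumes "\<And>i. i \<in> S \<Longrightarrow> g i \<in> H" and y: "y \<in> H"
  shows "ip (\<Sum>i\<in>S. c i *\<^sub>c g i) y = (\<Sum>i\<in>S. c i * ip (g i) y)"
  using assms(1)
proof (induction S rule: infinite_finite_induct)
  case (insert a S)
  have "g a \<in> H" "c a *\<^sub>c g a \<in> H" "(\<Sum>i\<in>S. c i *\<^sub>c g i) \<in> H"
    using insert.prems by (auto intro!: cseq.subspace_sum cseq.subspace_scale subspace_H)
  then have "ip (c a *\<^sub>c g a + (\<Sum>i\<in>S. c i *\<^sub>c g i)) y
      = c a * ip (g a) y + ip (\<Sum>i\<in>S. c i *\<^sub>c g i) y"
    by (simp only: ip_add_left ip_scale_left y)
  moreover have "ip (\<Sum>i\<in>S. c i *\<^sub>c g i) y = (\<Sum>i\<in>S. c i * ip (g i) y)"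
    using insert.prems by (intro insert.IH) auto
  ultimately show ?case
    by (simp only: sum.insert[OF insert(1,2)])
qed (simp_all only: sum.empty sum.infinite ip_0_left[OF y] not_False_eq_True)

lemma ip_sum_right:
  assumes "\<And>i. i \<in> S \<Longrightarrow> g i \<in> H" "y \<in> H"
  shows "ip y (\<Sum>i\<in>S. c i *\<^sub>c g i) = (\<Sum>i\<in>S. cnj (c i) * ip y (g i))"
proof -
  have "(\<Sum>i\<in>S. c i *\<^sub>c g i) \<in> H"
    using assms by (auto intro!: cseq.subspace_sum cseq.subspace_scale subspace_H)
  then have "ip y (\<Sum>i\<in>S. c i *\<^sub>c g i) = cnj (\<Sum>i\<in>S. c i * ip (g i) y)"
    using assms by (simp flip: ip_sum_left add: ip_cnj)
  also have "\<dots> = (\<Sum>i\<in>S. cnj (c i) * ip y (g i))"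
    using assms by (simp add: ip_cnj)
  finally show ?thesis .
qed

lemma inj_f: "inj f"
  by (metis injI orthonormal zero_neq_one)

lemma D_expansion:
  assumes "x \<in> D"
  obtains S c where "finite S" "x = (\<Sum>n\<in>S. c n *\<^sub>c f n)"
proof -
  obtain t r where t: "finite t" "t \<subseteq> range f" "x = (\<Sum>v\<in>t. r v *\<^sub>c v)"
    using assms unfolding cseq.span_explicit by blast
  then obtain S where S: "t = f ` S" by (meson subset_imageE)
  have inj: "inj_on f S" using inj_f inj_on_subset by blast
  show ?thesis
  proof
    show "finite S" using t S inj by (simp add: finite_image_iff)
    show "x = (\<Sum>n\<in>S. r (f n) *\<^sub>c f n)"
      unfolding t S using inj by (simp add: sum.reindex)
  qed
qed

lemma ip_expansion:
  assumes "finite S" "k \<in> S"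
  shows "ip (\<Sum>n\<in>S. c n *\<^sub>c f n) (f k) = c k"
  using assms by (simp add: ip_sum_left in_H orthonormal if_distrib cong: if_cong)

lemma independent_f: "cseq.independent (range f)"
proof
  assume "cseq.dependent (range f)"
  then obtain t u v where t: "finite t" "t \<subseteq> range f" "v \<in> t" "u v \<noteq> 0"
    and sum0: "(\<Sum>v\<in>t. u v *\<^sub>c v) = 0"
    unfolding cseq.dependent_explicit by blast
  then obtain S where S: "t = f ` S" by (meson subset_imageE)
  have inj: "inj_on f S" using inj_f inj_on_subset by blast
  obtain k where k: "v = f k" "k \<in> S" using t S by blast
  have "finite S" using t S inj by (simp add: finite_image_iff)
  \<comment> \<open>Zero is written as an empty combination, to which \<open>ip_sum_left\<close>
    applies.\<close>
  have "(\<Sum>n\<in>S. u (f n) *\<^sub>c f n) = (\<Sum>n\<in>{}. 0 *\<^sub>c f n)"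
    using sum0 unfolding S using inj by (simp add: sum.reindex)
  then have "u (f k) = ip (\<Sum>n\<in>{}. 0 *\<^sub>c f n) (f k)"
    using ip_expansion[OF \<open>finite S\<close> k(2), of "\<lambda>n. u (f n)"] by simp
  also have "\<dots> = 0"
    by (subst ip_sum_left) (auto simp: in_H)
  finally show False using t k by simp
qed

text \<open>Operators are total maps here: an independent set extends to a basis of all sequences,
  and \<open>g\<close> fixes the values on \<open>D\<close>.\<close>

lemma linear_extension:
  "\<exists>T. cseq_linear T \<and> (\<forall>n. T (f n) = g n)"
proof -
  obtain T where "cseq_linear T" "\<forall>x\<in>range f. T x = g (inv f x)"
    using cseq_pair.linear_independent_extend[OF independent_f, of "\<lambda>x. g (inv f x)"] by blast
  then show ?thesis
    using inv_f_f[OF inj_f] by auto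
qed

lemma linear_operator_on_D:
  assumes T: "cseq_linear T" and "\<And>n. T (f n) \<in> D"
  shows "linear_operator_on D T"
  unfolding linear_operator_on_def
proof (intro conjI ballI allI)
  fix x assume "x \<in> D"
  then obtain S c where x: "x = (\<Sum>n\<in>S. c n *\<^sub>c f n)" by (rule D_expansion)
  show "T x \<in> D"
    unfolding x using assms(2)
    by (auto simp: cseq_linear_simps[OF T] intro!: cseq.span_sum cseq.span_scale)
qed (rule cseq_linear_simps[OF T])+

lemma linear_eq_on_D:
  assumes "cseq_linear A" "cseq_linear B" "\<And>n. A (f n) = B (f n)" "x \<in> D"
  shows "A x = B x"
  using cseq_pair.linear_eq_on[OF assms(1,2,4)] assms(3) by auto

text \<open>Both sides expand sesquilinearly over the basis. The images are kept in \<open>D\<close>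
  because the rules for \<open>ip\<close> hold on \<open>H\<close> only.\<close>

lemma adjoint_on_D:
  assumes A: "cseq_linear A" "\<And>n. A (f n) \<in> D" and B: "cseq_linear B" "\<And>n. B (f n) \<in> D"
    and AB: "\<And>m n. ip (A (f m)) (f n) = ip (f m) (B (f n))"
    and xy: "x \<in> D" "y \<in> D"
  shows "ip (A x) y = ip x (B y)"
proof -
  obtain S c where x: "x = (\<Sum>n\<in>S. c n *\<^sub>c f n)" using xy(1) by (rule D_expansion)
  obtain T d where y: "y = (\<Sum>n\<in>T. d n *\<^sub>c f n)" using xy(2) by (rule D_expansion)
  have AH: "A (f n) \<in> H" and BH: "B (f n) \<in> H" for n
    using A(2) B(2) D_subset_H by blast+
  have xy': "x \<in> H" "y \<in> H" using xy D_subset_H by auto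
  have By: "B y = (\<Sum>n\<in>T. d n *\<^sub>c B (f n))"
    unfolding y by (simp add: cseq_linear_simps[OF B(1)])
  have "ip (A x) y = (\<Sum>m\<in>S. c m * ip (A (f m)) y)"
    using xy' AH unfolding x by (simp add: cseq_linear_simps[OF A(1)] ip_sum_left)
  also have "\<dots> = (\<Sum>m\<in>S. c m * (\<Sum>n\<in>T. cnj (d n) * ip (A (f m)) (f n)))"
    unfolding y using AH in_H by (simp add: ip_sum_right)
  also have "\<dots> = (\<Sum>m\<in>S. c m * ip (f m) (B y))"
    unfolding By AB using BH in_H by (simp add: ip_sum_right)
  also have "\<dots> = ip x (B y)"
    unfolding x By using BH in_H
    by (intro ip_sum_left[symmetric]) (auto intro!: cseq.subspace_sum cseq.subspace_scale subspace_H)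
  finally show ?thesis .
qed

text \<open>Eigenvectors other than the \<open>f n\<close> must be covered too. Comparing
  coefficients shows that an eigenvector for \<open>\<nu>\<close> involves only those
  \<open>f k\<close> with \<open>\<mu> k = \<nu>\<close>, and \<open>B\<close> multiplies all of
  these by \<open>\<phi> \<nu>\<close>.\<close>

lemma operator_function_on_D:
  assumes A: "cseq_linear A" "\<And>n. A (f n) = complex_of_real (\<mu> n) *\<^sub>c f n"
    and B: "cseq_linear B" "\<And>n. B (f n) = complex_of_real (\<phi> (\<mu> n)) *\<^sub>c f n"
  shows "operator_function D A \<phi> B"
  unfolding operator_function_def
proof (intro conjI ballI allI impI)
  show "linear_operator_on D B"
    using B f_in_D by (intro linear_operator_on_D) (auto intro: cseq.span_scale)
  let ?E = "{v \<in> D. \<exists>\<mu>::real. A v = complex_of_real \<mu> *\<^sub>c v}"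
  show "D = cseq.span ?E"
  proof
    show "D \<subseteq> cseq.span ?E"
      using A(2) f_in_D by (intro cseq.span_mono) auto
    show "cseq.span ?E \<subseteq> D"
      by (intro cseq.span_minimal cseq.subspace_span) auto
  qed
  fix v \<nu> assume "v \<in> D" and eig: "A v = complex_of_real \<nu> *\<^sub>c v"
  then obtain S c where S: "finite S" and v: "v = (\<Sum>n\<in>S. c n *\<^sub>c f n)"
    using D_expansion by blast
  have "(\<Sum>n\<in>S. (c n * \<mu> n) *\<^sub>c f n) = A v"
    unfolding v by (simp add: cseq_linear_simps[OF A(1)] A(2))
  also have "\<dots> = (\<Sum>n\<in>S. (\<nu> * c n) *\<^sub>c f n)"
    unfolding eig by (simp add: v cseq.scale_sum_right)
  finally have eq: "(\<Sum>n\<in>S. (c n * \<mu> n) *\<^sub>c f n) = (\<Sum>n\<in>S. (\<nu> * c n) *\<^sub>c f n)" .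
  have "c k * \<mu> k = \<nu> * c k" if "k \<in> S" for k
    using ip_expansion[OF S that, of "\<lambda>n. c n * \<mu> n"] ip_expansion[OF S that, of "\<lambda>n. \<nu> * c n"] eq
    by metis
  then have "c k = 0 \<or> \<mu> k = \<nu>" if "k \<in> S" for k
    using that by (metis mult.commute mult_cancel_left of_real_eq_iff)
  then have "c k * \<phi> (\<mu> k) = \<phi> \<nu> * c k" if "k \<in> S" for k
    using that by force
  then show "B v = complex_of_real (\<phi> \<nu>) *\<^sub>c v"
    unfolding v cseq_linear_simps[OF B(1)] B(2) cseq.scale_sum_right cseq.scale_scale
    by (intro sum.cong) simp_all
qed

end

section \<open>Properties of q-numbers\<close>

lemma qnum_0 [simp]: "qnum q 0 = 0"
  by (simp add: qnum_def)

lemma powr_half_less: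
  fixes q x :: real
  assumes "0 < q" "q < 1" "0 < x"
  shows "q powr (x / 2) < q powr (- x / 2)"
  using assms by (intro powr_less_mono') auto

lemma qnum_nonneg:
  assumes "0 < q" "q < 1" "0 \<le> x"
  shows "0 \<le> qnum q x"
proof (cases "x = 0")
  case False
  then show ?thesis
    unfolding qnum_def using powr_half_less[OF assms(1,2)] assms(3)
    by (intro divide_nonpos_neg) (auto simp: less_imp_le)
qed simp

lemma qnum_product_diff:
  assumes "0 < q" "q < 1"
  shows "qnum q x * qnum q (y + 1) - qnum q (x - 1) * qnum q y = qnum q (x + y)"
proof -
  \<comment> \<open>In these variables the claim becomes a rational identity.\<close>
  define u v t where "u = q powr (x / 2)" and "v = q powr (y / 2)" and "t = q powr (1 / 2)"
  have pos: "0 < u" "0 < v" "0 < t"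
    using assms by (simp_all add: u_def v_def t_def)
  have t: "t - 1 / t \<noteq> 0"
    using powr_half_less[OF assms, of 1] by (simp add: t_def powr_minus_divide)
  have powrs: "q powr (x / 2) = u" "q powr (- x / 2) = 1 / u"
    "q powr (y / 2) = v" "q powr (- y / 2) = 1 / v"
    "q powr (1 / 2) = t" "q powr (- 1 / 2) = 1 / t"
    "q powr ((y + 1) / 2) = v * t" "q powr (- (y + 1) / 2) = 1 / (v * t)"
    "q powr ((x - 1) / 2) = u / t" "q powr (- (x - 1) / 2) = t / u"
    "q powr ((x + y) / 2) = u * v" "q powr (- (x + y) / 2) = 1 / (u * v)"
    by (simp_all add: u_def v_def t_def add_divide_distrib diff_divide_distrib powr_diff
        flip: powr_add powr_minus_divide)
  have "qnum q x * qnum q (y + 1) - qnum q (x - 1) * qnum q y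
     = ((u - 1 / u) * (v * t - 1 / (v * t)) - (u / t - t / u) * (v - 1 / v)) / ((t - 1 / t) * (t - 1 / t))"
  proof -
    have "A / d * (B / d) - C / d * (E / d) = (A * B - C * E) / (d * d)" for A B C E d :: real
      by (simp add: diff_divide_distrib)
    then show ?thesis
      unfolding qnum_def powrs .
  qed
  also have "(u - 1 / u) * (v * t - 1 / (v * t)) - (u / t - t / u) * (v - 1 / v)
     = (u * v - 1 / (u * v)) * (t - 1 / t)"
    using pos by (simp add: field_simps)
  also have "\<dots> / ((t - 1 / t) * (t - 1 / t)) = qnum q (x + y)"
    unfolding qnum_def powrs using t by simp
  finally show ?thesis .
qed


context orthonormal_family
begin

theorem discrete_series_exists:
  assumes q: "0 < q" "q < 1" and l: "0 < l"
    and hilbert: "hilbert_space_on ip H" and dense: "closure_in ip H D = H"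
  obtains J0 Jp Jm B where
    "cseq_linear Jp" "cseq_linear Jm" "cseq_linear B"
    "discrete_series_rep q l ip H f J0 Jp Jm"
    "operator_function D J0 (\<lambda>\<mu>. q powr \<mu>) B"
    "\<And>n. B (f n) = complex_of_real (q powr (l + real n)) *\<^sub>c f n"
proof -
  \<comment> \<open>\<open>\<kappa> n\<close> is the coefficient of the lowering operator on
    \<open>f n\<close>, and \<open>\<kappa> (Suc n)\<close> that of the raising operator.\<close>
  define \<kappa> where "\<kappa> n = sqrt (qnum q (2 * l + real n - 1) * qnum q (real n))" for n
  have \<kappa>_0: "\<kappa> 0 = 0" by (simp add: \<kappa>_def)
  have \<kappa>_Suc: "\<kappa> (Suc n) = sqrt (qnum q (2 * l + real n) * qnum q (real n + 1))" for n
    by (simp add: \<kappa>_def add.commute)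
  \<comment> \<open>At \<open>n = 0\<close> the q-number of \<open>2 * l - 1\<close> may be
    negative, but the other factor is zero.\<close>
  have \<kappa>_sq: "\<kappa> n * \<kappa> n = qnum q (2 * l + real n - 1) * qnum q (real n)" for n
  proof (cases n)
    case (Suc m)
    then have "0 \<le> qnum q (2 * l + real n - 1) * qnum q (real n)"
      using l by (intro mult_nonneg_nonneg qnum_nonneg q) auto
    then show ?thesis by (simp add: \<kappa>_def)
  qed (simp add: \<kappa>_0)
  \<comment> \<open>The right side is the eigenvalue of [2 J0] on \<open>f n\<close>; it comes from
    the product identity at x = 2l + n, y = n.\<close>
  have \<kappa>_diff: "\<kappa> (Suc n) * \<kappa> (Suc n) - \<kappa> n * \<kappa> n = qnum q (2 * (l + real n))" for n
    using qnum_product_diff[OF q, of "2 * l + real n" "real n"]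
    by (simp add: \<kappa>_sq algebra_simps)
  obtain J0 where J0: "cseq_linear J0" "\<And>n. J0 (f n) = complex_of_real (l + real n) *\<^sub>c f n"
    using linear_extension[of "\<lambda>n. complex_of_real (l + real n) *\<^sub>c f n"] by metis
  obtain Jp where Jp: "cseq_linear Jp" "\<And>n. Jp (f n) = complex_of_real (\<kappa> (Suc n)) *\<^sub>c f (Suc n)"
    using linear_extension[of "\<lambda>n. complex_of_real (\<kappa> (Suc n)) *\<^sub>c f (Suc n)"] by metis
  obtain Jm where Jm: "cseq_linear Jm" "\<And>n. Jm (f n) = complex_of_real (\<kappa> n) *\<^sub>c f (n - 1)"
    using linear_extension[of "\<lambda>n. complex_of_real (\<kappa> n) *\<^sub>c f (n - 1)"] by metis
  obtain B where B: "cseq_linear B" "\<And>n. B (f n) = complex_of_real (q powr (l + real n)) *\<^sub>c f n"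
    using linear_extension[of "\<lambda>n. complex_of_real (q powr (l + real n)) *\<^sub>c f n"] by metis
  \<comment> \<open>\<open>C\<close> is the witness for [2 J0], as \<open>B\<close> is for
    q^J0.\<close>
  obtain C where C: "cseq_linear C" "\<And>n. C (f n) = complex_of_real (qnum q (2 * (l + real n))) *\<^sub>c f n"
    using linear_extension[of "\<lambda>n. complex_of_real (qnum q (2 * (l + real n))) *\<^sub>c f n"] by metis
  note lin = cseq_linear_simps[OF J0(1)] cseq_linear_simps[OF Jp(1)] cseq_linear_simps[OF Jm(1)]
  have in_D: "J0 (f n) \<in> D" "Jp (f n) \<in> D" "Jm (f n) \<in> D" for n
    unfolding J0 Jp Jm by (auto intro!: cseq.span_scale f_in_D)
  have comm_p: "J0 (Jp (f n)) - Jp (J0 (f n)) = Jp (f n)" for n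
    by (simp add: J0(2) Jp(2) lin fun_eq_iff cscale_apply algebra_simps)
  \<comment> \<open>At \<open>n = 0\<close> truncated subtraction yields \<open>f 0\<close>, which
    the coefficient \<open>\<kappa> 0 = 0\<close> removes.\<close>
  have comm_m: "J0 (Jm (f n)) - Jm (J0 (f n)) = (- 1) *\<^sub>c Jm (f n)" for n
    by (cases n) (simp_all add: J0(2) Jm(2) lin \<kappa>_0 fun_eq_iff cscale_apply algebra_simps)
  have comm_pm: "Jm (Jp (f n)) - Jp (Jm (f n)) = C (f n)" for n
  proof -
    have "Jp (Jm (f n)) = complex_of_real (\<kappa> n * \<kappa> n) *\<^sub>c f n"
      by (cases n) (simp_all add: Jp(2) Jm(2) lin \<kappa>_0)
    moreover have "Jm (Jp (f n)) = complex_of_real (\<kappa> (Suc n) * \<kappa> (Suc n)) *\<^sub>c f n"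
      by (simp add: Jp(2) Jm(2) lin)
    ultimately show ?thesis
      unfolding C(2) \<kappa>_diff[symmetric] by (simp add: cseq.scale_left_diff_distrib)
  qed
  have star_rep: "Uq_su11_star_rep q ip H D J0 Jp Jm"
    unfolding Uq_su11_star_rep_def
  proof (intro conjI)
    show "linear_operator_on D J0" "linear_operator_on D Jp" "linear_operator_on D Jm"
      by (intro linear_operator_on_D J0(1) Jp(1) Jm(1) in_D)+
    show "\<forall>x\<in>D. J0 (Jp x) - Jp (J0 x) = Jp x"
      using linear_eq_on_D[OF cseq_linear_comp_diff[OF J0(1) Jp(1)] Jp(1) comm_p] by blast
    \<comment> \<open>The sign is written as scaling by -1, whose linearity is at hand.\<close>
    have "cseq_linear (\<lambda>x. (- 1) *\<^sub>c Jm x)"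
      by (rule cseq_pair.linear_compose_scale_right[OF Jm(1)])
    then have "J0 (Jm x) - Jm (J0 x) = (- 1) *\<^sub>c Jm x" if "x \<in> D" for x
      by (rule linear_eq_on_D[OF cseq_linear_comp_diff[OF J0(1) Jm(1)] _ comm_m that])
    then show "\<forall>x\<in>D. J0 (Jm x) - Jm (J0 x) = - Jm x"
      by (simp only: cseq.scale_minus_left cseq.scale_one) blast
    have "operator_function D J0 (\<lambda>\<mu>. qnum q (2 * \<mu>)) C"
      by (rule operator_function_on_D[OF J0 C])
    moreover have "\<forall>x\<in>D. Jm (Jp x) - Jp (Jm x) = C x"
      using linear_eq_on_D[OF cseq_linear_comp_diff[OF Jm(1) Jp(1)] C(1) comm_pm] by blast
    ultimately show "\<exists>B. operator_function D J0 (\<lambda>\<mu>. qnum q (2 * \<mu>)) B \<and>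
        (\<forall>x\<in>D. Jm (Jp x) - Jp (Jm x) = B x)" by blast
    have "ip (J0 (f m)) (f n) = ip (f m) (J0 (f n))" for m n
      using ip_sum_left[of "{m}" f "f n" "\<lambda>m. complex_of_real (l + real m)"]
        ip_sum_right[of "{n}" f "f m" "\<lambda>n. complex_of_real (l + real n)"]
      by (simp add: J0(2) in_H orthonormal)
    then show "\<forall>x\<in>D. \<forall>y\<in>D. ip (J0 x) y = ip x (J0 y)"
      using adjoint_on_D[OF J0(1) in_D(1) J0(1) in_D(1)] by blast
    \<comment> \<open>Both sides are \<open>\<kappa> n\<close> for \<open>n = Suc m\<close> and zero
      otherwise. At \<open>n = 0\<close> the vanishing of \<open>\<kappa> 0\<close> excludes the
      false match of \<open>f (n - 1)\<close> with \<open>f 0\<close>.\<close>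
    have "ip (Jp (f m)) (f n) = ip (f m) (Jm (f n))" for m n
      using ip_sum_left[of "{m}" "\<lambda>m. f (Suc m)" "f n" "\<lambda>m. complex_of_real (\<kappa> (Suc m))"]
        ip_sum_right[of "{n}" "\<lambda>n. f (n - 1)" "f m" "\<lambda>n. complex_of_real (\<kappa> n)"]
      by (cases n) (simp_all add: Jp(2) Jm(2) in_H orthonormal \<kappa>_0)
    then show "\<forall>x\<in>D. \<forall>y\<in>D. ip (Jp x) y = ip x (Jm y)"
      using adjoint_on_D[OF Jp(1) in_D(2) Jm(1) in_D(3)] by blast
  qed (use D_subset_H dense in auto)
  have "f n \<noteq> 0" for n
    using independent_f cseq.dependent_zero[of "range f"] by (metis rangeI)
  then have "orthonormal_basis ip H f"
    unfolding orthonormal_basis_def orthogonal_basis_def using in_H orthonormal dense by simp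
  moreover have "ladder_action q l f Jp Jm"
    unfolding ladder_action_def using Jp(2) Jm(2) \<kappa>_Suc by (simp add: \<kappa>_def)
  ultimately have "discrete_series_rep q l ip H f J0 Jp Jm"
    unfolding discrete_series_rep_def using hilbert star_rep J0(2) by blast
  moreover have "operator_function D J0 (\<lambda>\<mu>. q powr \<mu>) B"
    by (rule operator_function_on_D[OF J0 B])
  ultimately show ?thesis
    using that[OF Jp(1) Jm(1) B(1) _ _ B(2)] by blast
qed

end

section \<open>The space \<open>H\<^sub>c\<close>\<close>

text \<open>The approximation condition depends on \<open>S\<close> alone, so imposing it twice
  changes nothing; this yields density of the span in \<open>H_c\<close>.\<close>

lemma closure_in_closure_in: "closure_in ip (closure_in ip L S) S = closure_in ip L S"
  by (auto simp: closure_in_def)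

text \<open>Transfers the homogeneous action formulas from the normalised vectors back to
  \<open>Pseq\<close>.\<close>

lemma cseq_linear_cancel_scale:
  assumes T: "cseq_linear T" and "r \<noteq> 0" and eq: "T (r *\<^sub>c x) = z *\<^sub>c (r *\<^sub>c y)"
  shows "T x = z *\<^sub>c y"
proof -
  have "r *\<^sub>c T x = r *\<^sub>c (z *\<^sub>c y)"
    using eq by (simp only: cseq_linear_simps[OF T] cseq.scale_scale mult.commute)
  then show ?thesis
    using \<open>r \<noteq> 0\<close> by (metis cseq.scale_left_imp_eq)
qed

text \<open>Identifies the domain of the operators with the span of the sequences before
  normalisation.\<close>

lemma span_scaled_range:
  assumes "r \<noteq> 0"
  shows "cseq.span (range (\<lambda>n. r *\<^sub>c p n)) = cseq.span (range p)"
proof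
  show "cseq.span (range (\<lambda>n. r *\<^sub>c p n)) \<subseteq> cseq.span (range p)"
    by (intro cseq.span_minimal cseq.subspace_span) (auto intro: cseq.span_scale cseq.span_base)
  have "p n \<in> cseq.span (range (\<lambda>n. r *\<^sub>c p n))" for n
  proof -
    have "inverse r *\<^sub>c (r *\<^sub>c p n) \<in> cseq.span (range (\<lambda>n. r *\<^sub>c p n))"
      by (intro cseq.span_scale cseq.span_base) auto
    moreover have "inverse r *\<^sub>c (r *\<^sub>c p n) = p n"
      using assms by simp
    ultimately show ?thesis by metis
  qed
  then show "cseq.span (range p) \<subseteq> cseq.span (range (\<lambda>n. r *\<^sub>c p n))"
    by (intro cseq.span_minimal cseq.subspace_span) auto
qed

context q_Laguerre_weight
begin

text \<open>Both infinite products are positive because q q^(2l - 1) = q^(2l) < 1.\<close>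

lemma b_const_pos: "0 < b_const q l c"
proof -
  have *: "q * q powr (2 * l - 1) = a"
    using q by (simp add: powr_diff)
  show ?thesis
    unfolding b_const_def qpoch_real_def * using q c a_less_1 qpoch_inf_pos[OF q] by simp
qed

sublocale weighted_l2 "weight q l c" "b_const q l c"
  by unfold_locales (rule weight_pos b_const_pos)+

lemma l2c_eq: "l2c q l c = L2"
  by (simp add: l2c_def L2_def)

lemma ip_c_eq: "ip_c q l c = ip"
  by (intro ext) (simp add: ip_c_def ip_def)

lemma Pseq_in_L2: "Pseq q l c n \<in> L2"
  using has_sum_imp_summable[OF has_sum_P_product[of n n]]
  by (simp add: L2_def Pseq_def power2_eq_square flip: abs_mult)

text \<open>The free factor serves twice: a suitable \<open>r\<close> gives orthonormality, and
  \<open>r = 1\<close> orthogonality of \<open>Pseq\<close> itself.\<close>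

lemma ip_scaled_Pseq:
  "ip (complex_of_real r *\<^sub>c Pseq q l c m) (complex_of_real r *\<^sub>c Pseq q l c n)
     = (if m = n then complex_of_real (r * r * (b_const q l c * moment 0)) else 0)"
proof -
  have "complex_of_real (w k) * (complex_of_real r *\<^sub>c Pseq q l c m) k
      * cnj ((complex_of_real r *\<^sub>c Pseq q l c n) k)
    = complex_of_real (r * r * (w k * (P q l m (lam q c k) * P q l n (lam q c k))))" for k
    by (simp add: Pseq_def cscale_apply)
  then have "ip (complex_of_real r *\<^sub>c Pseq q l c m) (complex_of_real r *\<^sub>c Pseq q l c n)
    = complex_of_real (b_const q l c) * (\<Sum>\<^sub>\<infinity>k. complex_of_real
        (r * r * (w k * (P q l m (lam q c k) * P q l n (lam q c k)))))"
    by (simp only: ip_def)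
  also have "\<dots> = complex_of_real (b_const q l c * (r * r * (if m = n then moment 0 else 0)))"
    unfolding infsum_complex_of_real infsum_cmult_right' infsumI[OF has_sum_P_product] by simp
  finally show ?thesis by simp
qed

end

theorem theorem5:
  fixes q l c :: real
  assumes "0 < q" and "q < 1" and "l > 0" and "c > 0"
  shows "(\<forall>n. Pseq q l c n \<in> l2c q l c) \<and>
    orthogonal_basis (ip_c q l c) (H_c q l c) (Pseq q l c) \<and>
    (\<exists>J0 Jp Jm qJ0 r.
       r > 0 \<and>
       discrete_series_rep q l (ip_c q l c) (H_c q l c)
         (\<lambda>n. complex_of_real r *\<^sub>c Pseq q l c n) J0 Jp Jm \<and>
       operator_function (cseq.span (range (Pseq q l c))) J0 (\<lambda>\<mu>. q powr \<mu>) qJ0 \<and>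
       (\<forall>n. qJ0 (Pseq q l c n) = complex_of_real (q powr (l + real n)) *\<^sub>c Pseq q l c n) \<and>
       (\<forall>n. Jp (Pseq q l c n) =
          complex_of_real (sqrt (qnum q (2 * l + real n) * qnum q (real n + 1)))
            *\<^sub>c Pseq q l c (n + 1)) \<and>
       (\<forall>n. Jm (Pseq q l c n) =
          complex_of_real (sqrt (qnum q (2 * l + real n - 1) * qnum q (real n)))
            *\<^sub>c Pseq q l c (n - 1)))"
proof -
  interpret q_Laguerre_weight q l c
    using assms by unfold_locales
  let ?p = "Pseq q l c" and ?S = "cseq.span (range (Pseq q l c))"
  have SL2: "?S \<subseteq> L2"
    using Pseq_in_L2 by (intro cseq.span_minimal subspace_L2) auto
  have H: "H_c q l c = closure_in ip L2 ?S"
    by (simp only: H_c_def ip_c_eq l2c_eq)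
  have dense: "closure_in ip (H_c q l c) ?S = H_c q l c"
    unfolding H by (rule closure_in_closure_in)
  have hilbert: "hilbert_space_on ip (H_c q l c)"
    unfolding H by (intro hilbert_space_closure_in_L2 cseq.subspace_span SL2)
  have S_H: "?S \<subseteq> H_c q l c"
    unfolding H by (rule subset_closure_in_L2[OF SL2])
  \<comment> \<open>All \<open>?p n\<close> have squared norm
    \<open>b_const q l c * moment 0\<close>, so one factor normalises them all.\<close>
  define r where "r = 1 / sqrt (b_const q l c * moment 0)"
  have pos: "0 < b_const q l c * moment 0"
    using b_const_pos moment_0_pos by simp
  then have r: "0 < r" "r * r * (b_const q l c * moment 0) = 1"
    using b_const_pos moment_0_pos by (simp_all add: r_def)
  let ?f = "\<lambda>n. complex_of_real r *\<^sub>c ?p n"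
  have r0: "complex_of_real r \<noteq> 0" using r by simp
  note span_f = span_scaled_range[OF r0, of ?p]
  interpret orthonormal_family ip "H_c q l c" ?f
  proof
    show "inner_product_on ip (H_c q l c)"
      using hilbert by (simp add: hilbert_space_on_def)
    show "?f n \<in> H_c q l c" for n
      using S_H cseq.span_scale[OF cseq.span_base] by blast
    show "ip (?f m) (?f n) = (if m = n then 1 else 0)" for m n
      unfolding ip_scaled_Pseq r(2) by simp
  qed
  obtain J0 Jp Jm B where lin: "cseq_linear Jp" "cseq_linear Jm" "cseq_linear B"
    and rep: "discrete_series_rep q l ip (H_c q l c) ?f J0 Jp Jm"
    and B: "operator_function ?S J0 (\<lambda>\<mu>. q powr \<mu>) B"
    and B_f: "\<And>n. B (?f n) = complex_of_real (q powr (l + real n)) *\<^sub>c ?f n"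
    using discrete_series_exists[OF assms(1-3) hilbert dense[folded span_f]]
    unfolding span_f by metis
  have ladder: "ladder_action q l ?f Jp Jm" and basis: "orthonormal_basis ip (H_c q l c) ?f"
    using rep by (simp_all add: discrete_series_rep_def)
  have "orthogonal_basis ip (H_c q l c) ?p"
    unfolding orthogonal_basis_def
  proof (intro conjI allI impI)
    fix m n
    show "?p n \<in> H_c q l c"
      using S_H cseq.span_base by blast
    show "?p n \<noteq> 0"
      using basis cseq.scale_zero_right unfolding orthonormal_basis_def orthogonal_basis_def by metis
    show "ip (?p m) (?p n) = 0" if "m \<noteq> n"
      using ip_scaled_Pseq[of 1 m n] that by (simp only: of_real_1 cseq.scale_one if_False)
  qed (rule dense)
  moreover have "B (?p n) = complex_of_real (q powr (l + real n)) *\<^sub>c ?p n" for n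
    by (rule cseq_linear_cancel_scale[OF lin(3) r0 B_f])
  moreover note ladder[unfolded ladder_action_def, THEN conjunct1, rule_format,
      THEN cseq_linear_cancel_scale[OF lin(1) r0]]
  moreover note ladder[unfolded ladder_action_def, THEN conjunct2, rule_format,
      THEN cseq_linear_cancel_scale[OF lin(2) r0]]
  ultimately show ?thesis
    unfolding ip_c_eq l2c_eq using Pseq_in_L2 r(1) rep B
    by (intro conjI allI exI[of _ J0] exI[of _ Jp] exI[of _ Jm] exI[of _ B] exI[of _ r])
qed

end
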